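(* Let $m\ge 0$ be an integer. There is a unique pair $(u,W)$ of real functions solving, for $r>0$, $$u''+\frac{1}{r}u'-\frac{m^2}{r^2}u=(W-1)u,\qquad W''+\frac{1}{r}W'=|u|^2,$$ with $u$ continuous on $[0,\infty)$, $W$ extending to a $C^1$ function on $[0,\infty)$ with $W(0)=W'(0)=0$, and such that $u(r)>0$ for all $r>0$ and $u(r)\to 0$ as $r\to\infty$.
   Context: These are the radial equations $\Delta(u e^{im\theta})=(W-1)u e^{im\theta}$, $\Delta W=|u|^2$ on $\mathbb{R}^2$ in polar coordinates $(r,\theta)$. *)

theory Defs
  imports "HOL-Analysis.Analysis"
begin

definition radial_solution :: "nat \<Rightarrow> (real \<Rightarrow> real) \<Rightarrow> (real \<Rightarrow> real) \<Rightarrow> bool" where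
  "radial_solution m u W \<longleftrightarrow>
     (\<forall>r>0. u differentiable (at r) \<and> deriv u differentiable (at r)
          \<and> W differentiable (at r) \<and> deriv W differentiable (at r)
          \<and> deriv (deriv u) r + deriv u r / r - (real m)^2 / r^2 * u r = (W r - 1) * u r
          \<and> deriv (deriv W) r + deriv W r / r = \<bar>u r\<bar>^2)
   \<and> continuous_on {0..} u
   \<and> continuous_on {0..} W
   \<and> W 0 = 0
   \<and> (W has_real_derivative 0) (at 0 within {0..})
   \<and> (deriv W \<longlongrightarrow> 0) (at_right 0)
   \<and> (\<forall>r>0. u r > 0)
   \<and> (u \<longlongrightarrow> 0) at_top"

end

theory Submission
  imports Defs
begin

text \<open>
  Existence is by shooting. Writing \<open>u = sqrt \<beta> * r ^ m * v\<close> with \<open>v 0 = 1\<close>, the system becomes a fixed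
  point problem for \<open>v\<close> with parameter \<open>\<beta>\<close>; truncating \<open>v\<close> to \<open>[0, 1]\<close> in the nonlinearity makes it globally
  Lipschitz, so that \<open>v\<close> exists on the whole half-line and depends continuously on \<open>\<beta>\<close>. The parameters
  for which \<open>v\<close> becomes negative and those for which \<open>v\<close> increases somewhere while positive form two
  disjoint open sets, the first containing \<open>0\<close> and the second \<open>32 * (2 * m + 2)\<^sup>2\<close>; a parameter
  in neither set gives a positive decreasing \<open>v\<close>, whence \<open>W\<close> grows logarithmically and \<open>u\<close> decays.

  For uniqueness let \<open>p = ln (u2 / u1)\<close>, \<open>D = W2 - W1\<close> and \<open>w = r * (u1 * u2' - u2 * u1')\<close>. Then
  \<open>w' = r * u1 * u2 * D\<close>, \<open>p' = w / (r * u1 * u2)\<close> and \<open>(r * D')' = r * (u2\<^sup>2 - u1\<^sup>2)\<close>, and \<open>p\<close> has a limit at the origin.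
  If the limit is positive, then \<open>p\<close>, \<open>D\<close> and \<open>w\<close> stay positive, \<open>w\<close> is bounded below at infinity and
  \<open>(u1 / u2)' = - w / (r * u2\<^sup>2)\<close> drives \<open>u1 / u2\<close> to minus infinity. If the limit is zero, a weighted
  supremum estimate gives \<open>p = D = 0\<close>.
\<close>

text \<open>Factoring out \<open>r ^ m\<close> absorbs the singular term \<open>m^2 / r^2\<close>,
  and \<open>sqrt \<beta>\<close>, the leading coefficient of \<open>u\<close> at the origin,
  becomes the only shooting datum. Truncation costs nothing: at the selected parameter
  \<open>0 < v <= 1\<close>. The two parameter sets are disjoint because both events are
  irreversible. In particular a positive slope of \<open>v\<close> requires \<open>W > 1\<close>,
  and \<open>W\<close> never decreases, so the slope stays positive. Avoiding both sets only yields
  \<open>v >= 0\<close>; strict positivity is backward uniqueness at a double zero.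

  In the uniqueness part the obstacle is the origin. The equation is singular there,
  \<open>u\<close> is only known to be continuous and may vanish, so neither \<open>w -> 0\<close>
  nor a limit of \<open>p\<close> is evident. The first follows in the variable \<open>ln r\<close>:
  \<open>r * u'\<close> is monotone near the origin, and a nonzero limit would make \<open>u\<close>
  logarithmically unbounded. The second rests on a one-sided Harnack bound
  \<open>u s <= C * u t\<close> for \<open>s <= t\<close>, which controls
  \<open>w / (r * u1 * u2)\<close> although the denominator degenerates. A negative limit of
  \<open>p\<close> becomes a positive one when the solutions are swapped.\<close>

lemma first_zero:
  fixes f :: "real \<Rightarrow> real"
  assumes f: "continuous_on {a..b} f" and ab: "a \<le> b" and "f a < 0" "0 \<le> f b"
  obtains e where "a < e" "e \<le> b" "f e = 0" "\<And>x. a \<le> x \<Longrightarrow> x < e \<Longrightarrow> f x < 0"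
proof -
  let ?Z = "{x \<in> {a..b}. f x = 0}"
  have "closed ?Z"
    using continuous_closed_preimage_constant[OF f closed_atLeastAtMost, of 0] by (simp add: Collect_conj_eq)
  then have "compact ?Z"
    by (rule compact_Int_closed[of "{a..b}" ?Z, OF compact_Icc, THEN back_subst[of compact]]) auto
  moreover have "?Z \<noteq> {}"
    using IVT'[of f a 0 b] assms by auto
  ultimately have "\<exists>e\<in>?Z. \<forall>z\<in>?Z. e \<le> z" by (rule compact_attains_inf)
  then obtain e where e: "e \<in> ?Z" and min: "\<And>z. z \<in> ?Z \<Longrightarrow> e \<le> z"
    by meson
  have "f x < 0" if x: "a \<le> x" "x < e" for x
  proof (rule ccontr)
    assume "\<not> f x < 0"
    moreover have "continuous_on {a..x} f" using continuous_on_subset[OF f] e x by auto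
    ultimately obtain z where "a \<le> z" "z \<le> x" "f z = 0"
      using IVT'[of f a 0 x] x assms(3) by auto
    then show False using min[of z] e x by simp
  qed
  moreover have "a < e" using e assms(3) by (cases "a = e") auto
  ultimately show thesis using that e by auto
qed

section \<open>The inverse radial Laplacian\<close>

text \<open>For \<open>t > 0\<close> this is \<open>t^(-n)\<close> times the integral of
  \<open>s^n * h s\<close>, the derivative of the regular solution of
  \<open>f'' + (n / r) * f' = h\<close>. The kernel is written \<open>(s / t) ^ n\<close> because it
  stays between 0 and 1, so bounds on \<open>h\<close> pass directly to the flux.\<close>

definition radial_flux :: "nat \<Rightarrow> (real \<Rightarrow> real) \<Rightarrow> real \<Rightarrow> real" where
  "radial_flux n h t = integral {0..t} (\<lambda>s. (s / t) ^ n * h s)"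

definition radial_potential :: "nat \<Rightarrow> (real \<Rightarrow> real) \<Rightarrow> real \<Rightarrow> real" where
  "radial_potential n h r = integral {0..r} (radial_flux n h)"

lemma radial_flux_0 [simp]: "radial_flux n h 0 = 0"
  by (simp add: radial_flux_def)

lemma radial_potential_0 [simp]: "radial_potential n h 0 = 0"
  by (simp add: radial_potential_def)

lemma power_times_radial_flux:
  assumes "t > 0"
  shows "t ^ n * radial_flux n h t = integral {0..t} (\<lambda>s. s ^ n * h s)"
proof -
  have "t ^ n * radial_flux n h t = integral {0..t} (\<lambda>s. t ^ n * ((s / t) ^ n * h s))"
    by (simp add: radial_flux_def)
  also have "(\<lambda>s. t ^ n * ((s / t) ^ n * h s)) = (\<lambda>s. s ^ n * h s)"
    using assms by (auto simp: power_divide)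
  finally show ?thesis .
qed

lemma integrable_radial_flux:
  fixes h :: "real \<Rightarrow> real"
  assumes "continuous_on {0..} h" "t \<ge> 0"
  shows "(\<lambda>s. (s / t) ^ n * h s) integrable_on {0..t}"
proof -
  have "continuous_on {0..t} h"
    using assms(1) by (rule continuous_on_subset) auto
  then have "continuous_on {0..t} (\<lambda>s. (s * inverse t) ^ n * h s)"
    by (intro continuous_intros)
  then show ?thesis
    by (intro integrable_continuous_real) (simp add: divide_inverse)
qed

lemma radial_flux_mono:
  assumes "continuous_on {0..} g" "continuous_on {0..} h" "t \<ge> 0"
    and "\<And>s. 0 \<le> s \<Longrightarrow> s \<le> t \<Longrightarrow> g s \<le> h s"
  shows "radial_flux n g t \<le> radial_flux n h t"
  unfolding radial_flux_def
  by (rule integral_le) (use assms in \<open>auto intro!: integrable_radial_flux mult_left_mono\<close>)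

lemma radial_flux_diff:
  assumes "continuous_on {0..} g" "continuous_on {0..} h" "t \<ge> 0"
  shows "radial_flux n (\<lambda>s. g s - h s) t = radial_flux n g t - radial_flux n h t"
  using integral_diff[OF integrable_radial_flux[OF assms(1,3)] integrable_radial_flux[OF assms(2,3)]]
  by (simp add: radial_flux_def right_diff_distrib)

lemma radial_flux_power:
  assumes "t \<ge> 0"
  shows "radial_flux n (\<lambda>s. c * s ^ j) t = c * t ^ Suc j / real (n + j + 1)"
proof (cases "t = 0")
  case False
  then have t: "t > 0" using assms by simp
  have "((\<lambda>s. s ^ n * (c * s ^ j)) has_integral
      c * t ^ (n + j + 1) / real (n + j + 1) - c * 0 ^ (n + j + 1) / real (n + j + 1)) {0..t}"
  proof (rule fundamental_theorem_of_calculus)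
    fix x assume "x \<in> {0..t}"
    show "((\<lambda>s. c * s ^ (n + j + 1) / real (n + j + 1)) has_vector_derivative x ^ n * (c * x ^ j))
        (at x within {0..t})"
      unfolding has_real_derivative_iff_has_vector_derivative[symmetric]
      by (rule derivative_eq_intros refl | simp add: power_add)+
  qed (use t in simp)
  then have "t ^ n * radial_flux n (\<lambda>s. c * s ^ j) t = t ^ n * (c * t ^ Suc j / real (n + j + 1))"
    unfolding power_times_radial_flux[OF t] by (simp add: integral_unique power_add)
  with t show ?thesis by (metis mult_cancel_left power_not_zero less_irrefl)
qed simp

lemma abs_radial_flux_le:
  assumes "continuous_on {0..} h" "t \<ge> 0"
    and "\<And>s. 0 \<le> s \<Longrightarrow> s \<le> t \<Longrightarrow> \<bar>h s\<bar> \<le> M"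
  shows "\<bar>radial_flux n h t\<bar> \<le> M * t"
proof -
  have M: "M \<ge> 0" using assms(3)[of 0] assms(2) by force
  have "radial_flux n h t \<le> radial_flux n (\<lambda>s. M * s ^ 0) t"
    by (rule radial_flux_mono) (use assms in \<open>fastforce intro!: continuous_intros\<close>)+
  moreover have "radial_flux n (\<lambda>s. - M * s ^ 0) t \<le> radial_flux n h t"
    by (rule radial_flux_mono) (use assms in \<open>fastforce intro!: continuous_intros\<close>)+
  ultimately have "\<bar>radial_flux n h t\<bar> \<le> M * t / real (n + 1)"
    unfolding radial_flux_power[OF assms(2)] by simp
  also have "\<dots> \<le> M * t"
    using M assms(2) by (simp add: divide_le_eq algebra_simps)
  finally show ?thesis .
qed

lemma DERIV_power_times_radial_flux:
  assumes "continuous_on {0..} h" "t > 0"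
  shows "((\<lambda>t. t ^ n * radial_flux n h t) has_real_derivative t ^ n * h t) (at t)"
proof -
  have "continuous_on {0..t+1} h"
    using assms(1) by (rule continuous_on_subset) auto
  then have "continuous_on {0..t+1} (\<lambda>s. s ^ n * h s)"
    by (intro continuous_intros)
  then have "((\<lambda>t. integral {0..t} (\<lambda>s. s ^ n * h s)) has_real_derivative t ^ n * h t)
      (at t within {0..t+1})"
    using assms(2) by (intro integral_has_real_derivative) auto
  then have "((\<lambda>t. integral {0..t} (\<lambda>s. s ^ n * h s)) has_real_derivative t ^ n * h t) (at t)"
    using assms(2) by (simp add: at_within_Icc_at)
  then show ?thesis
    by (rule has_field_derivative_transform_within_open[where S = "{0<..}"])
      (use assms(2) in \<open>auto simp: power_times_radial_flux\<close>)
qed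

text \<open>The product rule turns the divergence form \<open>(t^n * f')' = t^n * h\<close> into
  \<open>f'' + (n / t) * f' = h\<close>, the radial Laplacian in dimension
  \<open>n + 1\<close>.\<close>

lemma DERIV_radial_flux:
  assumes "continuous_on {0..} h" "t > 0"
  shows "(radial_flux n h has_real_derivative h t - real n / t * radial_flux n h t) (at t)"
proof -
  have "((\<lambda>t. (t ^ n * radial_flux n h t) / t ^ n) has_real_derivative
      ((t ^ n * h t) * t ^ n - (t ^ n * radial_flux n h t) * (real n * t ^ (n - 1))) / (t ^ n * t ^ n)) (at t)"
    using assms(2)
    by (intro DERIV_divide DERIV_power_times_radial_flux[OF assms] DERIV_pow[of n t, simplified]) auto
  moreover have "((t ^ n * h t) * t ^ n - (t ^ n * radial_flux n h t) * (real n * t ^ (n - 1))) / (t ^ n * t ^ n)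
      = h t - real n / t * radial_flux n h t"
    using assms(2) by (cases n) (simp_all add: field_simps)
  ultimately have "((\<lambda>t. (t ^ n * radial_flux n h t) / t ^ n) has_real_derivative
      h t - real n / t * radial_flux n h t) (at t)"
    by simp
  then show ?thesis
    by (rule has_field_derivative_transform_within_open[where S = "{0<..}"]) (use assms(2) in auto)
qed

lemma continuous_on_radial_flux:
  assumes "continuous_on {0..} h"
  shows "continuous_on {0..} (radial_flux n h)"
  unfolding continuous_on_eq_continuous_within
proof
  fix t :: real assume "t \<in> {0..}"
  show "continuous (at t within {0..}) (radial_flux n h)"
  proof (cases "t = 0")
    case False
    then show ?thesis
      using DERIV_isCont[OF DERIV_radial_flux[OF assms, of t n]] \<open>t \<in> {0..}\<close>
      by (auto intro: continuous_at_imp_continuous_at_within)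
  next
    case True
    have "compact (h ` {0..1})"
      by (intro compact_continuous_image continuous_on_subset[OF assms]) auto
    then have "bounded (h ` {0..1})" by (rule compact_imp_bounded)
    then obtain M where M: "\<And>s. s \<in> {0..1} \<Longrightarrow> \<bar>h s\<bar> \<le> M"
      unfolding bounded_iff by (metis imageI real_norm_def)
    have "(radial_flux n h \<longlongrightarrow> 0) (at 0 within {0..})"
    proof (rule Lim_null_comparison)
      show "\<forall>\<^sub>F t in at 0 within {0..}. norm (radial_flux n h t) \<le> M * t"
        unfolding eventually_at
        by (rule exI[of _ 1]) (auto intro!: abs_radial_flux_le assms M simp: dist_real_def)
      show "((\<lambda>t. M * t) \<longlongrightarrow> 0) (at 0 within {0..})"
        by (auto intro!: tendsto_eq_intros)
    qed
    then show ?thesis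
      by (simp add: True continuous_within)
  qed
qed

lemma DERIV_radial_potential_within:
  assumes "continuous_on {0..} h" "r \<ge> 0"
  shows "(radial_potential n h has_real_derivative radial_flux n h r) (at r within {0..})"
proof -
  have "continuous_on {0..r+1} (radial_flux n h)"
    using continuous_on_radial_flux[OF assms(1)] by (rule continuous_on_subset) auto
  then have "((\<lambda>r. integral {0..r} (radial_flux n h)) has_real_derivative radial_flux n h r)
      (at r within {0..r+1})"
    using assms(2) by (intro integral_has_real_derivative) auto
  moreover have "at r within {0..r+1} = at r within {0..}"
    by (rule at_within_nhd[where S = "{..<r+1}"]) auto
  ultimately show ?thesis
    by (simp add: radial_potential_def[abs_def])
qed

lemma DERIV_radial_potential:
  assumes "continuous_on {0..} h" "r > 0"
  shows "(radial_potential n h has_real_derivative radial_flux n h r) (at r)"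
  using DERIV_radial_potential_within[OF assms(1), of r n] assms(2)
  by (simp add: at_within_interior[of r "{0..}"])

lemma continuous_on_radial_potential:
  assumes "continuous_on {0..} h"
  shows "continuous_on {0..} (radial_potential n h)"
  using DERIV_radial_potential_within[OF assms] by (auto intro!: DERIV_continuous_on)

text \<open>The flux at \<open>t\<close> is at most \<open>t\<close> times the supremum of
  \<open>|h|\<close> on \<open>{0..t}\<close>, hence at most the derivative of
  \<open>\<Phi>\<close>. The majorant is left free: it is quadratic for plain bounds and an
  exponential weight for the contraction.\<close>

lemma abs_radial_potential_le:
  assumes h: "continuous_on {0..} h" and r: "r \<ge> 0"
    and \<Phi>: "\<And>t. t \<ge> 0 \<Longrightarrow> (\<Phi> has_real_derivative \<phi> t) (at t)"
    and le: "\<And>s t. 0 \<le> s \<Longrightarrow> s \<le> t \<Longrightarrow> t \<le> r \<Longrightarrow> t * \<bar>h s\<bar> \<le> \<phi> t"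
  shows "\<bar>radial_potential n h r\<bar> \<le> \<Phi> r - \<Phi> 0"
proof -
  have flux: "\<bar>radial_flux n h t\<bar> \<le> \<phi> t" if "t > 0" "t \<le> r" for t
  proof -
    have "\<bar>radial_flux n h t\<bar> \<le> (\<phi> t / t) * t"
      by (rule abs_radial_flux_le[OF h]) (use le that in \<open>auto simp: field_simps\<close>)
    then show ?thesis using that by simp
  qed
  have cont: "continuous_on {0..r} (radial_potential n h)"
    using continuous_on_radial_potential[OF h] by (rule continuous_on_subset) auto
  have cont': "continuous_on {0..r} \<Phi>"
    by (intro continuous_at_imp_continuous_on ballI DERIV_isCont[OF \<Phi>]) auto
  have "\<Phi> 0 - radial_potential n h 0 \<le> \<Phi> r - radial_potential n h r"
  proof (rule DERIV_nonneg_imp_increasing_open[OF r])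
    fix t assume "0 < t" "t < r"
    then show "\<exists>y. ((\<lambda>t. \<Phi> t - radial_potential n h t) has_real_derivative y) (at t) \<and> 0 \<le> y"
      using flux[of t] by (intro exI[of _ "\<phi> t - radial_flux n h t"] conjI DERIV_diff \<Phi>
        DERIV_radial_potential[OF h]) auto
  qed (intro continuous_intros cont cont')
  moreover have "\<Phi> 0 + radial_potential n h 0 \<le> \<Phi> r + radial_potential n h r"
  proof (rule DERIV_nonneg_imp_increasing_open[OF r])
    fix t assume "0 < t" "t < r"
    then show "\<exists>y. ((\<lambda>t. \<Phi> t + radial_potential n h t) has_real_derivative y) (at t) \<and> 0 \<le> y"
      using flux[of t] by (intro exI[of _ "\<phi> t + radial_flux n h t"] conjI DERIV_add \<Phi>
        DERIV_radial_potential[OF h]) auto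
  qed (intro continuous_intros cont cont')
  ultimately show ?thesis by simp
qed

lemma abs_radial_potential_le_const:
  assumes "continuous_on {0..} h" "r \<ge> 0"
    and "\<And>s. 0 \<le> s \<Longrightarrow> s \<le> r \<Longrightarrow> \<bar>h s\<bar> \<le> M"
  shows "\<bar>radial_potential n h r\<bar> \<le> M * r\<^sup>2"
proof -
  have M: "M \<ge> 0" using assms(3)[of 0] assms(2) by force
  have "\<bar>radial_potential n h r\<bar> \<le> M * r\<^sup>2 / 2 - M * 0\<^sup>2 / 2"
  proof (rule abs_radial_potential_le[OF assms(1,2), where \<phi> = "\<lambda>t. t * M"])
    show "((\<lambda>t. M * t\<^sup>2 / 2) has_real_derivative t * M) (at t)" for t
      by (rule derivative_eq_intros refl | simp)+
    show "t * \<bar>h s\<bar> \<le> t * M" if "0 \<le> s" "s \<le> t" "t \<le> r" for s t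
      using that assms(3) by (intro mult_left_mono) auto
  qed
  also have "\<dots> \<le> M * r\<^sup>2" using M by simp
  finally show ?thesis .
qed

lemma radial_potential_diff:
  assumes "continuous_on {0..} g" "continuous_on {0..} h" "r \<ge> 0"
  shows "radial_potential n (\<lambda>s. g s - h s) r = radial_potential n g r - radial_potential n h r"
proof -
  have int: "radial_flux n f integrable_on {0..r}" if "continuous_on {0..} f" for f
    by (intro integrable_continuous_real continuous_on_subset[OF continuous_on_radial_flux[OF that]]) auto
  have "integral {0..r} (radial_flux n (\<lambda>s. g s - h s))
      = integral {0..r} (\<lambda>t. radial_flux n g t - radial_flux n h t)"
    by (rule integral_cong) (use assms in \<open>auto simp: radial_flux_diff\<close>)
  then show ?thesis
    by (simp add: radial_potential_def integral_diff int assms)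
qed

section \<open>The truncated fixed point problem\<close>

text \<open>Both cut-offs matter. The upper one bounds the nonlinearity before any bound on
  \<open>v\<close> is known; the lower one switches the source off where \<open>v\<close> is
  negative, which keeps such a profile from returning to positive values.\<close>

definition clip :: "real \<Rightarrow> real" where
  "clip x = max 0 (min 1 x)"

lemma clip_nonneg [simp]: "0 \<le> clip x" and clip_le_1 [simp]: "clip x \<le> 1"
  by (simp_all add: clip_def)

lemma abs_clip_le: "\<bar>clip x\<bar> \<le> \<bar>x\<bar>"
  by (auto simp: clip_def)

lemma abs_clip_diff_le: "\<bar>clip x - clip y\<bar> \<le> \<bar>x - y\<bar>"
  by (auto simp: clip_def)

lemma continuous_on_clip [continuous_intros]:
  "continuous_on S f \<Longrightarrow> continuous_on S (\<lambda>x. clip (f x))"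
  unfolding clip_def by (intro continuous_intros)

text \<open>
  Both operators invert radial Laplacians: the equation for \<open>W\<close> is the one in dimension 2, the one for
  \<open>v = u / (sqrt \<beta> * r ^ m)\<close> lives in dimension \<open>2 * m + 2\<close>.
\<close>

definition screening :: "nat \<Rightarrow> real \<Rightarrow> (real \<Rightarrow> real) \<Rightarrow> real \<Rightarrow> real" where
  "screening m \<beta> v = radial_potential 1 (\<lambda>s. \<beta> * s ^ (2 * m) * (clip (v s))\<^sup>2)"

definition picard_step :: "nat \<Rightarrow> real \<Rightarrow> (real \<Rightarrow> real) \<Rightarrow> real \<Rightarrow> real" where
  "picard_step m \<beta> v r =
     1 + radial_potential (2 * m + 1) (\<lambda>s. (screening m \<beta> v s - 1) * clip (v s)) r"

lemma continuous_on_screening: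
  assumes "continuous_on {0..} v"
  shows "continuous_on {0..} (screening m \<beta> v)"
  unfolding screening_def
  by (intro continuous_on_radial_potential continuous_intros assms)

lemma continuous_on_source:
  assumes "continuous_on {0..} v"
  shows "continuous_on {0..} (\<lambda>s. (screening m \<beta> v s - 1) * clip (v s))"
  by (intro continuous_intros continuous_on_screening assms)

lemma continuous_on_picard_step:
  assumes "continuous_on {0..} v"
  shows "continuous_on {0..} (picard_step m \<beta> v)"
  unfolding picard_step_def
  by (intro continuous_intros continuous_on_radial_potential continuous_on_source assms)

lemma abs_screening_le:
  assumes v: "continuous_on {0..} v" and "0 \<le> \<beta>" "0 \<le> r"
  shows "\<bar>screening m \<beta> v r\<bar> \<le> \<beta> * r ^ (2 * m + 2)"
proof -
  have "\<bar>screening m \<beta> v r\<bar> \<le> (\<beta> * r ^ (2 * m)) * r\<^sup>2"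
    unfolding screening_def
  proof (rule abs_radial_potential_le_const)
    show "continuous_on {0..} (\<lambda>s. \<beta> * s ^ (2 * m) * (clip (v s))\<^sup>2)"
      by (intro continuous_intros v)
    fix s assume s: "0 \<le> s" "s \<le> r"
    have "\<beta> * s ^ (2 * m) * (clip (v s))\<^sup>2 \<le> \<beta> * r ^ (2 * m) * 1"
      by (intro mult_mono power_mono) (use assms s in \<open>auto simp: power_le_one\<close>)
    then show "\<bar>\<beta> * s ^ (2 * m) * (clip (v s))\<^sup>2\<bar> \<le> \<beta> * r ^ (2 * m)"
      using assms s by (simp add: abs_mult)
  qed (use assms in auto)
  then show ?thesis by (simp add: power_add power2_eq_square mult_ac)
qed

lemma abs_screening_diff_le:
  assumes v: "continuous_on {0..} v1" "continuous_on {0..} v2" and "0 \<le> \<beta>" "0 \<le> r"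
    and E: "\<And>s. 0 \<le> s \<Longrightarrow> s \<le> r \<Longrightarrow> \<bar>v1 s - v2 s\<bar> \<le> E"
  shows "\<bar>screening m \<beta> v1 r - screening m \<beta> v2 r\<bar> \<le> 2 * \<beta> * r ^ (2 * m + 2) * E"
proof -
  let ?h = "\<lambda>v s. \<beta> * s ^ (2 * m) * (clip (v s))\<^sup>2"
  have c: "continuous_on {0..} (?h v1)" "continuous_on {0..} (?h v2)"
    by (intro continuous_intros v)+
  have "\<bar>radial_potential 1 (\<lambda>s. ?h v1 s - ?h v2 s) r\<bar> \<le> (2 * \<beta> * r ^ (2 * m) * E) * r\<^sup>2"
  proof (rule abs_radial_potential_le_const)
    show "continuous_on {0..} (\<lambda>s. ?h v1 s - ?h v2 s)"
      by (intro continuous_intros v)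
    fix s assume s: "0 \<le> s" "s \<le> r"
    have "\<bar>(clip (v1 s))\<^sup>2 - (clip (v2 s))\<^sup>2\<bar> = \<bar>clip (v1 s) + clip (v2 s)\<bar> * \<bar>clip (v1 s) - clip (v2 s)\<bar>"
      unfolding abs_mult[symmetric] by (simp only: power2_eq_square square_diff_square_factored)
    also have "\<dots> \<le> 2 * E"
    proof (rule mult_mono)
      show "\<bar>clip (v1 s) + clip (v2 s)\<bar> \<le> 2"
        using add_mono[OF clip_le_1[of "v1 s"] clip_le_1[of "v2 s"]] by simp
      show "\<bar>clip (v1 s) - clip (v2 s)\<bar> \<le> E"
        using abs_clip_diff_le[of "v1 s" "v2 s"] E[OF s] by linarith
    qed auto
    finally have "\<bar>\<beta> * s ^ (2 * m)\<bar> * \<bar>(clip (v1 s))\<^sup>2 - (clip (v2 s))\<^sup>2\<bar> \<le> (\<beta> * r ^ (2 * m)) * (2 * E)"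
      by (intro mult_mono) (use assms s in \<open>auto intro!: mult_left_mono power_mono\<close>)
    then show "\<bar>?h v1 s - ?h v2 s\<bar> \<le> 2 * \<beta> * r ^ (2 * m) * E"
      by (simp add: abs_mult[symmetric] algebra_simps)
  qed (use assms in auto)
  then show ?thesis
    unfolding screening_def radial_potential_diff[OF c \<open>0 \<le> r\<close>]
    by (simp add: power_add power2_eq_square mult_ac)
qed

text \<open>The factor 3 is 2 + 1: the difference of the screenings contributes 2, from
  \<open>a^2 - b^2 = (a + b) * (a - b)\<close> with \<open>a\<close>, \<open>b\<close> at most 1,
  and the size of the second screening contributes 1.\<close>

lemma abs_source_diff_le:
  assumes v: "continuous_on {0..} v1" "continuous_on {0..} v2" and "0 \<le> \<beta>" "0 \<le> r"
    and E: "\<And>s. 0 \<le> s \<Longrightarrow> s \<le> r \<Longrightarrow> \<bar>v1 s - v2 s\<bar> \<le> E"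
  shows "\<bar>(screening m \<beta> v1 r - 1) * clip (v1 r) - (screening m \<beta> v2 r - 1) * clip (v2 r)\<bar>
    \<le> (3 * \<beta> * r ^ (2 * m + 2) + 1) * E"
proof -
  let ?W1 = "screening m \<beta> v1 r" and ?W2 = "screening m \<beta> v2 r"
  have "(?W1 - 1) * clip (v1 r) - (?W2 - 1) * clip (v2 r)
      = (?W1 - ?W2) * clip (v1 r) + (?W2 - 1) * (clip (v1 r) - clip (v2 r))"
    by (simp add: algebra_simps)
  also have "\<bar>\<dots>\<bar> \<le> \<bar>?W1 - ?W2\<bar> * \<bar>clip (v1 r)\<bar> + \<bar>?W2 - 1\<bar> * \<bar>clip (v1 r) - clip (v2 r)\<bar>"
    unfolding abs_mult[symmetric] by (rule abs_triangle_ineq)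
  also have "\<dots> \<le> (2 * \<beta> * r ^ (2 * m + 2) * E) * 1 + (\<beta> * r ^ (2 * m + 2) + 1) * E"
  proof (intro add_mono mult_mono)
    show "\<bar>?W1 - ?W2\<bar> \<le> 2 * \<beta> * r ^ (2 * m + 2) * E"
      by (rule abs_screening_diff_le) fact+
    show "\<bar>?W2 - 1\<bar> \<le> \<beta> * r ^ (2 * m + 2) + 1"
      using abs_screening_le[OF v(2) \<open>0 \<le> \<beta>\<close> \<open>0 \<le> r\<close>, of m] by linarith
    show "\<bar>clip (v1 r) - clip (v2 r)\<bar> \<le> E"
      using abs_clip_diff_le[of "v1 r" "v2 r"] E[of r] \<open>0 \<le> r\<close> by force
    show "0 \<le> 2 * \<beta> * r ^ (2 * m + 2) * E" 
      using E[of r] assms(3,4) by (intro mult_nonneg_nonneg) auto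
  qed (use assms(3,4) in auto)
  finally show ?thesis by (simp add: algebra_simps)
qed

text \<open>
  The exponent is chosen so that \<open>2 * t * (3 * B * t ^ (2 * m + 2) + 1)\<close> is its derivative; this makes the
  fixed point map halve distances in the weighted supremum norm.
\<close>

definition growth_weight :: "nat \<Rightarrow> real \<Rightarrow> real \<Rightarrow> real" where
  "growth_weight m B t = exp (t\<^sup>2 + 3 * B * t ^ (2 * m + 4) / real (m + 2))"

lemma growth_weight_0 [simp]: "growth_weight m B 0 = 1"
  by (simp add: growth_weight_def)

lemma growth_weight_pos [simp]: "growth_weight m B t > 0"
  by (simp add: growth_weight_def)

lemma growth_weight_mono:
  assumes "0 \<le> B" "0 \<le> s" "s \<le> t"
  shows "growth_weight m B s \<le> growth_weight m B t"
  unfolding growth_weight_def exp_le_cancel_iff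
  by (intro add_mono divide_right_mono mult_left_mono power_mono) (use assms in auto)

lemma DERIV_growth_weight:
  "(growth_weight m B has_real_derivative
      2 * t * (3 * B * t ^ (2 * m + 2) + 1) * growth_weight m B t) (at t)"
proof -
  have "((\<lambda>t. t\<^sup>2 + 3 * B * t ^ (2 * m + 4) / real (m + 2)) has_real_derivative
      2 * t + 3 * B * (real (2 * m + 4) * t ^ (2 * m + 3)) / real (m + 2)) (at t)"
    by (rule derivative_eq_intros refl | simp add: add.commute)+
  moreover have "2 * t + 3 * B * (real (2 * m + 4) * t ^ (2 * m + 3)) / real (m + 2)
      = 2 * t * (3 * B * t ^ (2 * m + 2) + 1)"
  proof -
    have "real (2 * m + 4) = 2 * real (m + 2)" by simp
    moreover have "t ^ (2 * m + 3) = t * t ^ (2 * m + 2)"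
      by (simp add: power_add power3_eq_cube power2_eq_square)
    moreover have "real (m + 2) \<noteq> 0" by simp
    ultimately show ?thesis
      by (simp only:) (simp only: distrib_left times_divide_eq_right[symmetric] mult_ac nonzero_mult_div_cancel_left, simp)
  qed
  ultimately have "((\<lambda>t. t\<^sup>2 + 3 * B * t ^ (2 * m + 4) / real (m + 2)) has_real_derivative
      2 * t * (3 * B * t ^ (2 * m + 2) + 1)) (at t)" by simp
  from DERIV_fun_exp[OF this] show ?thesis
    by (simp add: growth_weight_def[abs_def] mult.commute)
qed

lemma picard_step_contraction:
  assumes v: "continuous_on {0..} v1" "continuous_on {0..} v2"
    and \<beta>: "0 \<le> \<beta>" "\<beta> \<le> B" and r: "0 \<le> r" and "0 \<le> \<epsilon>"
    and le: "\<And>s. 0 \<le> s \<Longrightarrow> s \<le> r \<Longrightarrow> \<bar>v1 s - v2 s\<bar> \<le> \<epsilon> * growth_weight m B s"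
  shows "\<bar>picard_step m \<beta> v1 r - picard_step m \<beta> v2 r\<bar> \<le> \<epsilon> / 2 * (growth_weight m B r - 1)"
proof -
  let ?g = "\<lambda>v s. (screening m \<beta> v s - 1) * clip (v s)"
  have "\<bar>radial_potential (2 * m + 1) (\<lambda>s. ?g v1 s - ?g v2 s) r\<bar>
      \<le> \<epsilon> / 2 * growth_weight m B r - \<epsilon> / 2 * growth_weight m B 0"
  proof (rule abs_radial_potential_le[OF _ r])
    show "continuous_on {0..} (\<lambda>s. ?g v1 s - ?g v2 s)"
      by (intro continuous_intros continuous_on_source v continuous_on_screening)
    show "((\<lambda>r. \<epsilon> / 2 * growth_weight m B r) has_real_derivative
        \<epsilon> / 2 * (2 * t * (3 * B * t ^ (2 * m + 2) + 1) * growth_weight m B t)) (at t)" for t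
      by (intro DERIV_cmult DERIV_growth_weight)
    fix s t assume st: "0 \<le> s" "s \<le> t" "t \<le> r"
    have B: "0 \<le> B" using \<beta> by simp
    have "\<bar>?g v1 s - ?g v2 s\<bar> \<le> (3 * \<beta> * s ^ (2 * m + 2) + 1) * (\<epsilon> * growth_weight m B s)"
    proof (rule abs_source_diff_le[OF v])
      fix x assume x: "0 \<le> x" "x \<le> s"
      then have "\<bar>v1 x - v2 x\<bar> \<le> \<epsilon> * growth_weight m B x" using le st by simp
      also have "\<dots> \<le> \<epsilon> * growth_weight m B s"
        using x B \<open>0 \<le> \<epsilon>\<close> by (intro mult_left_mono growth_weight_mono) auto
      finally show "\<bar>v1 x - v2 x\<bar> \<le> \<epsilon> * growth_weight m B s" .
    qed (use \<beta> st in auto)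
    also have "\<dots> \<le> (3 * B * t ^ (2 * m + 2) + 1) * (\<epsilon> * growth_weight m B t)"
      by (intro mult_mono add_mono power_mono growth_weight_mono order_refl)
        (use \<beta> st B \<open>0 \<le> \<epsilon>\<close> in \<open>auto intro!: mult_nonneg_nonneg less_imp_le[OF growth_weight_pos]\<close>)
    finally have "t * \<bar>?g v1 s - ?g v2 s\<bar> \<le> t * ((3 * B * t ^ (2 * m + 2) + 1) * (\<epsilon> * growth_weight m B t))"
      using st by (intro mult_left_mono) auto
    then show "t * \<bar>?g v1 s - ?g v2 s\<bar> \<le> \<epsilon> / 2 * (2 * t * (3 * B * t ^ (2 * m + 2) + 1) * growth_weight m B t)"
      by (simp add: algebra_simps)
  qed
  then show ?thesis
    unfolding picard_step_def radial_potential_diff[OF continuous_on_source[OF v(1)] continuous_on_source[OF v(2)] r]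
    by (simp add: algebra_simps)
qed

section \<open>Global profiles by the contraction principle\<close>

lemma picard_step_zero: "r \<ge> 0 \<Longrightarrow> picard_step m \<beta> (\<lambda>_. 0) r = 1"
  using abs_radial_potential_le_const[of "\<lambda>_. 0" r 0 "2 * m + 1"]
  by (simp add: picard_step_def clip_def)

text \<open>Banach's theorem is applied to bounded continuous \<open>g\<close> with
  \<open>v = g * E\<close>, so that the sup norm of \<open>g\<close> is the weighted norm of
  \<open>v\<close>. Bounded continuous functions live on the whole line; \<open>max 0 r\<close>
  extends the image constantly to negative arguments.\<close>

lemma picard_fixpoint_exists:
  assumes \<beta>: "0 \<le> \<beta>"
  shows "\<exists>v. continuous_on {0..} v \<and> (\<forall>r\<ge>0. v r = picard_step m \<beta> v r)"
proof -
  define E where "E = growth_weight m \<beta>"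
  define lift where "lift g s = g s * E s" for g :: "real \<Rightarrow> real" and s
  define T where "T g r = picard_step m \<beta> (lift g) (max 0 r) / E (max 0 r)" for g r
  have E: "E s > 0" for s by (simp add: E_def)
  have E1: "E s \<ge> 1" if "s \<ge> 0" for s
    using growth_weight_mono[OF \<beta> order_refl that, of m] by (simp add: E_def)
  have contE: "continuous_on S E" for S
    unfolding E_def using DERIV_growth_weight
    by (intro continuous_at_imp_continuous_on ballI) (rule DERIV_isCont)
  have cont_lift: "continuous_on {0..} (lift (apply_bcontfun g))" for g :: "real \<Rightarrow>\<^sub>C real"
    unfolding lift_def by (intro continuous_intros contE continuous_on_apply_bcontfun)
  have contr: "\<bar>picard_step m \<beta> (lift g) x - picard_step m \<beta> v2 x\<bar> \<le> e / 2 * (E x - 1)"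
    if "continuous_on {0..} v2" "\<And>s. s \<ge> 0 \<Longrightarrow> \<bar>lift g s - v2 s\<bar> \<le> e * E s" "x \<ge> 0" "e \<ge> 0"
    for g :: "real \<Rightarrow>\<^sub>C real" and v2 x e
    unfolding E_def
    by (rule picard_step_contraction[OF cont_lift]) (use that \<beta> in \<open>auto simp: E_def\<close>)
  have T: "T (apply_bcontfun g) \<in> bcontfun" for g
    unfolding bcontfun_def
  proof (intro CollectI conjI)
    show "continuous_on UNIV (T g)"
      unfolding T_def
    proof (intro continuous_on_divide)
      show "continuous_on UNIV (\<lambda>r. picard_step m \<beta> (lift g) (max 0 r))"
        by (rule continuous_on_compose2[OF continuous_on_picard_step[OF cont_lift]])
          (auto intro!: continuous_intros)
      show "continuous_on UNIV (\<lambda>r. E (max 0 r))"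
        by (rule continuous_on_compose2[OF contE[of UNIV]]) (auto intro!: continuous_intros)
      show "\<forall>x\<in>UNIV. E (max 0 x) \<noteq> 0" using E by (metis less_irrefl)
    qed
    obtain b where b: "\<And>s. \<bar>apply_bcontfun g s\<bar> \<le> b"
      using bounded_apply_bcontfun[of g] unfolding bounded_iff by (metis rangeI real_norm_def)
    then have b0: "b \<ge> 0" using abs_ge_zero order_trans by blast
    \<comment> \<open>Boundedness is a case of the contraction estimate: compare with the zero
      function, which \<open>picard_step\<close> maps to the constant 1.\<close>
    have "\<bar>T g r\<bar> \<le> 1 + b / 2" for r
    proof -
      let ?x = "max 0 r"
      have "\<bar>picard_step m \<beta> (lift g) ?x - picard_step m \<beta> (\<lambda>_. 0) ?x\<bar> \<le> b / 2 * (E ?x - 1)"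
        by (rule contr) (use b b0 E in \<open>auto simp: lift_def abs_mult less_imp_le intro!: mult_mono\<close>)
      then have "\<bar>picard_step m \<beta> (lift g) ?x - 1\<bar> \<le> b / 2 * E ?x"
        using b0 by (simp add: picard_step_zero algebra_simps)
      then have "\<bar>picard_step m \<beta> (lift g) ?x\<bar> \<le> 1 + b / 2 * E ?x" by linarith
      also have "\<dots> \<le> (1 + b / 2) * E ?x"
        using E1[of ?x] by (simp add: algebra_simps)
      finally show ?thesis
        unfolding T_def using E[of ?x] by (simp add: field_simps)
    qed
    then show "bounded (range (T g))"
      unfolding bounded_iff by (intro exI[of _ "1 + b / 2"]) auto
  qed
  define F where "F g = Bcontfun (T (apply_bcontfun g))" for g
  have F: "apply_bcontfun (F g) = T g" for g
    unfolding F_def using T by (simp add: Bcontfun_inverse)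
  have "dist (F g) (F h) \<le> 1 / 2 * dist g h" for g h
  proof (rule dist_bound)
    fix r :: real
    let ?x = "max 0 r"
    have "\<bar>picard_step m \<beta> (lift g) ?x - picard_step m \<beta> (lift h) ?x\<bar> \<le> dist g h / 2 * (E ?x - 1)"
    proof (rule contr[OF cont_lift])
      fix s
      have "\<bar>lift g s - lift h s\<bar> = dist (g s) (h s) * E s"
        using E[of s] by (simp add: lift_def dist_real_def abs_mult flip: left_diff_distrib)
      also have "\<dots> \<le> dist g h * E s"
        using E[of s] by (intro mult_right_mono dist_bounded) auto
      finally show "\<bar>lift g s - lift h s\<bar> \<le> dist g h * E s" .
    qed auto
    also have "\<dots> \<le> dist g h / 2 * E ?x"
      by (intro mult_left_mono) auto
    finally show "dist (F g r) (F h r) \<le> 1 / 2 * dist g h"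
      unfolding F T_def using E[of ?x]
      by (simp add: dist_real_def field_simps flip: diff_divide_distrib)
  qed
  then obtain g where g: "F g = g"
    using banach_fix_type[of "1/2" F] by auto
  have "lift g r = picard_step m \<beta> (lift g) r" if "r \<ge> 0" for r
  proof -
    have "apply_bcontfun g r = picard_step m \<beta> (lift g) r / E r"
      using fun_cong[OF F[of g], of r] that by (simp add: g T_def)
    then show ?thesis using E[of r] by (simp add: lift_def)
  qed
  with cont_lift show ?thesis by blast
qed

definition shooting :: "nat \<Rightarrow> real \<Rightarrow> real \<Rightarrow> real" where
  "shooting m \<beta> =
     (SOME v. continuous_on {0..} v \<and> (\<forall>r\<ge>0. v r = picard_step m \<beta> v r))"

lemma continuous_on_shooting: "0 \<le> \<beta> \<Longrightarrow> continuous_on {0..} (shooting m \<beta>)"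
  and shooting_fixpoint: "0 \<le> \<beta> \<Longrightarrow> 0 \<le> r \<Longrightarrow> shooting m \<beta> r = picard_step m \<beta> (shooting m \<beta>) r"
  using someI_ex[OF picard_fixpoint_exists[of \<beta> m]] by (auto simp: shooting_def)

section \<open>Continuous dependence on the shooting parameter\<close>

lemma abs_screening_param_diff_le:
  assumes v: "continuous_on {0..} v" and "0 \<le> r"
  shows "\<bar>screening m \<beta> v r - screening m \<gamma> v r\<bar> \<le> \<bar>\<beta> - \<gamma>\<bar> * r ^ (2 * m + 2)"
proof -
  let ?h = "\<lambda>\<beta> s. \<beta> * s ^ (2 * m) * (clip (v s))\<^sup>2"
  have c: "continuous_on {0..} (?h b)" for b
    by (intro continuous_intros v)
  have "\<bar>radial_potential 1 (\<lambda>s. ?h \<beta> s - ?h \<gamma> s) r\<bar> \<le> (\<bar>\<beta> - \<gamma>\<bar> * r ^ (2 * m)) * r\<^sup>2"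
  proof (rule abs_radial_potential_le_const)
    show "continuous_on {0..} (\<lambda>s. ?h \<beta> s - ?h \<gamma> s)"
      by (intro continuous_intros v)
    fix s assume s: "0 \<le> s" "s \<le> r"
    have "\<bar>?h \<beta> s - ?h \<gamma> s\<bar> = \<bar>\<beta> - \<gamma>\<bar> * s ^ (2 * m) * (clip (v s))\<^sup>2"
      using s by (simp add: abs_mult flip: left_diff_distrib)
    also have "\<dots> \<le> \<bar>\<beta> - \<gamma>\<bar> * r ^ (2 * m) * 1"
      by (intro mult_mono power_mono) (use s in \<open>auto simp: power_le_one\<close>)
    finally show "\<bar>?h \<beta> s - ?h \<gamma> s\<bar> \<le> \<bar>\<beta> - \<gamma>\<bar> * r ^ (2 * m)" by simp
  qed (use assms in auto)
  then show ?thesis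
    unfolding screening_def radial_potential_diff[OF c c \<open>0 \<le> r\<close>]
    by (simp add: power_add power2_eq_square mult_ac)
qed

lemma abs_picard_step_param_diff_le:
  assumes v: "continuous_on {0..} v" and r: "0 \<le> r"
  shows "\<bar>picard_step m \<beta> v r - picard_step m \<gamma> v r\<bar> \<le> \<bar>\<beta> - \<gamma>\<bar> * r ^ (2 * m + 4)"
proof -
  let ?g = "\<lambda>\<beta> s. (screening m \<beta> v s - 1) * clip (v s)"
  have "\<bar>radial_potential (2 * m + 1) (\<lambda>s. ?g \<beta> s - ?g \<gamma> s) r\<bar> \<le> (\<bar>\<beta> - \<gamma>\<bar> * r ^ (2 * m + 2)) * r\<^sup>2"
  proof (rule abs_radial_potential_le_const)
    show "continuous_on {0..} (\<lambda>s. ?g \<beta> s - ?g \<gamma> s)"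
      by (intro continuous_intros continuous_on_screening v)
    fix s assume s: "0 \<le> s" "s \<le> r"
    have "\<bar>?g \<beta> s - ?g \<gamma> s\<bar> = \<bar>screening m \<beta> v s - screening m \<gamma> v s\<bar> * clip (v s)"
      by (simp add: abs_mult flip: left_diff_distrib)
    also have "\<dots> \<le> (\<bar>\<beta> - \<gamma>\<bar> * s ^ (2 * m + 2)) * 1"
      by (intro mult_mono abs_screening_param_diff_le v) (use s in auto)
    also have "\<dots> \<le> \<bar>\<beta> - \<gamma>\<bar> * r ^ (2 * m + 2)"
      using s by (auto intro!: mult_left_mono power_mono simp del: power_Suc)
    finally show "\<bar>?g \<beta> s - ?g \<gamma> s\<bar> \<le> \<bar>\<beta> - \<gamma>\<bar> * r ^ (2 * m + 2)" .
  qed (use assms in auto)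
  then show ?thesis
    unfolding picard_step_def radial_potential_diff[OF continuous_on_source[OF v] continuous_on_source[OF v] r]
    by (simp add: numeral_eq_Suc mult_ac)
qed

text \<open>Let \<open>M\<close> be the weighted supremum of the difference on
  \<open>{0..r}\<close>, attained at \<open>x\<close>. The contraction accounts for at most half of
  \<open>M * E x\<close> and the change of parameter for the rest, so \<open>M\<close> is at most
  twice the parameter error.\<close>

lemma abs_shooting_diff_le:
  assumes \<beta>: "0 \<le> \<beta>" "\<beta> \<le> B" and \<gamma>: "0 \<le> \<gamma>" and r: "0 \<le> r"
  shows "\<bar>shooting m \<beta> r - shooting m \<gamma> r\<bar> \<le> 2 * (\<bar>\<beta> - \<gamma>\<bar> * r ^ (2 * m + 4)) * growth_weight m B r"
proof -
  define E where "E = growth_weight m B"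
  let ?v = "shooting m \<beta>" and ?w = "shooting m \<gamma>" and ?d = "\<bar>\<beta> - \<gamma>\<bar> * r ^ (2 * m + 4)"
  have E: "E s > 0" for s by (simp add: E_def)
  have B: "0 \<le> B" using \<beta> by simp
  have E1: "E s \<ge> 1" if "s \<ge> 0" for s
    using growth_weight_mono[OF B order_refl that, of m] by (simp add: E_def)
  have contE: "continuous_on S E" for S
    unfolding E_def using DERIV_growth_weight
    by (intro continuous_at_imp_continuous_on ballI) (rule DERIV_isCont)
  have c: "continuous_on {0..} ?v" "continuous_on {0..} ?w"
    using continuous_on_shooting \<beta> \<gamma> by auto
  have "continuous_on {0..r} (\<lambda>s. \<bar>?v s - ?w s\<bar> / E s)"
    using E by (intro continuous_intros contE continuous_on_subset[OF c(1)] continuous_on_subset[OF c(2)])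
      (auto simp: less_imp_neq[symmetric])
  then obtain x where x: "x \<in> {0..r}" and sup: "\<And>s. s \<in> {0..r} \<Longrightarrow> \<bar>?v s - ?w s\<bar> / E s \<le> \<bar>?v x - ?w x\<bar> / E x"
    using continuous_attains_sup[of "{0..r}" "\<lambda>s. \<bar>?v s - ?w s\<bar> / E s"] r by auto
  define M where "M = \<bar>?v x - ?w x\<bar> / E x"
  have M0: "M \<ge> 0" using E[of x] by (simp add: M_def)
  have le: "\<bar>?v s - ?w s\<bar> \<le> M * E s" if "s \<in> {0..r}" for s
    using sup[OF that] E[of s] by (simp add: M_def[symmetric] divide_le_eq)
  have "\<bar>picard_step m \<beta> ?v x - picard_step m \<beta> ?w x\<bar> \<le> M / 2 * (E x - 1)"
    unfolding E_def by (rule picard_step_contraction[OF c \<beta>]) (use x le M0 in \<open>auto simp: E_def\<close>)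
  moreover have "\<bar>picard_step m \<beta> ?w x - picard_step m \<gamma> ?w x\<bar> \<le> \<bar>\<beta> - \<gamma>\<bar> * x ^ (2 * m + 4)"
    by (rule abs_picard_step_param_diff_le) (use c x in auto)
  moreover have "\<bar>\<beta> - \<gamma>\<bar> * x ^ (2 * m + 4) \<le> ?d"
    by (intro mult_left_mono power_mono) (use x in auto)
  moreover have "?v x - ?w x = picard_step m \<beta> ?v x - picard_step m \<gamma> ?w x"
    using shooting_fixpoint[of \<beta> x m] shooting_fixpoint[of \<gamma> x m] \<beta> \<gamma> x by simp
  ultimately have "\<bar>?v x - ?w x\<bar> \<le> M / 2 * (E x - 1) + ?d" by linarith
  moreover have "\<bar>?v x - ?w x\<bar> = M * E x" using E[of x] by (simp add: M_def)
  moreover have "M / 2 * (E x - 1) = M * E x / 2 - M / 2" by (simp add: field_simps)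
  ultimately have "M * E x \<le> 2 * ?d" using M0 by linarith
  moreover have "M * 1 \<le> M * E x" using E1[of x] M0 x by (intro mult_left_mono) auto
  ultimately have "M \<le> 2 * ?d" by linarith
  then have "M * E r \<le> 2 * ?d * E r" using E[of r] by (intro mult_right_mono) auto
  with le[of r] r have "\<bar>?v r - ?w r\<bar> \<le> 2 * ?d * E r" by simp
  then show ?thesis by (simp add: E_def)
qed

lemma continuous_on_shooting_param:
  assumes r: "0 \<le> r"
  shows "continuous_on {0..} (\<lambda>\<beta>. shooting m \<beta> r)"
  unfolding continuous_on_def
proof
  fix \<beta> :: real assume "\<beta> \<in> {0..}"
  then have \<beta>: "0 \<le> \<beta>" by simp
  define L where "L = 2 * r ^ (2 * m + 4) * growth_weight m \<beta> r"
  have "((\<lambda>\<gamma>. shooting m \<gamma> r - shooting m \<beta> r) \<longlongrightarrow> 0) (at \<beta> within {0..})"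
  proof (rule Lim_null_comparison)
    show "\<forall>\<^sub>F \<gamma> in at \<beta> within {0..}. norm (shooting m \<gamma> r - shooting m \<beta> r) \<le> L * \<bar>\<beta> - \<gamma>\<bar>"
      using abs_shooting_diff_le[OF \<beta> order_refl _ r]
      by (auto simp: eventually_at_filter abs_minus_commute L_def mult_ac intro!: always_eventually)
    have "((\<lambda>\<gamma>. L * \<bar>\<beta> - \<gamma>\<bar>) \<longlongrightarrow> L * \<bar>\<beta> - \<beta>\<bar>) (at \<beta> within {0..})"
      by (intro tendsto_intros)
    then show "((\<lambda>\<gamma>. L * \<bar>\<beta> - \<gamma>\<bar>) \<longlongrightarrow> 0) (at \<beta> within {0..})" by simp
  qed
  then show "((\<lambda>\<gamma>. shooting m \<gamma> r) \<longlongrightarrow> shooting m \<beta> r) (at \<beta> within {0..})"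
    by (simp add: LIM_zero_iff)
qed

section \<open>Shape of the shooting profiles\<close>

lemma radial_flux_const: "0 \<le> t \<Longrightarrow> radial_flux n (\<lambda>_. c) t = c * t / real (n + 1)"
  using radial_flux_power[of t n c 0] by simp

lemma radial_flux_nonneg:
  assumes "continuous_on {0..} h" "t \<ge> 0" "\<And>s. 0 \<le> s \<Longrightarrow> s \<le> t \<Longrightarrow> 0 \<le> h s"
  shows "0 \<le> radial_flux n h t"
  using radial_flux_mono[of "\<lambda>_. 0" h t n] assms radial_flux_const[of t n 0]
  by (simp add: continuous_on_const)

locale shooting_profile =
  fixes m :: nat and \<beta> :: real
  assumes \<beta>_nonneg: "0 \<le> \<beta>"
begin

definition v :: "real \<Rightarrow> real" where "v = shooting m \<beta>"
definition W :: "real \<Rightarrow> real" where "W = screening m \<beta> v"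
definition src :: "real \<Rightarrow> real" where "src s = (W s - 1) * clip (v s)"
definition dv :: "real \<Rightarrow> real" where "dv = radial_flux (2 * m + 1) src"
definition dW :: "real \<Rightarrow> real" where
  "dW = radial_flux 1 (\<lambda>s. \<beta> * s ^ (2 * m) * (clip (v s))\<^sup>2)"

lemma cont_v: "continuous_on {0..} v"
  unfolding v_def by (rule continuous_on_shooting[OF \<beta>_nonneg])

lemma cont_W: "continuous_on {0..} W"
  unfolding W_def by (rule continuous_on_screening[OF cont_v])

lemma cont_src: "continuous_on {0..} src"
  unfolding src_def by (intro continuous_intros cont_v cont_W)

lemma cont_rhs: "continuous_on {0..} (\<lambda>s. \<beta> * s ^ (2 * m) * (clip (v s))\<^sup>2)"
  by (intro continuous_intros cont_v)

lemma v_eq: "0 \<le> r \<Longrightarrow> v r = 1 + radial_potential (2 * m + 1) src r"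
  using shooting_fixpoint[OF \<beta>_nonneg, of r m]
  by (simp add: v_def[symmetric] picard_step_def W_def[symmetric] src_def[abs_def])

lemma v_0 [simp]: "v 0 = 1"
  by (simp add: v_eq)

lemma W_0 [simp]: "W 0 = 0"
  by (simp add: W_def screening_def)

lemma DERIV_v: "0 < r \<Longrightarrow> (v has_real_derivative dv r) (at r)"
proof -
  assume r: "0 < r"
  have "((\<lambda>r. 1 + radial_potential (2 * m + 1) src r) has_real_derivative 0 + dv r) (at r)"
    unfolding dv_def by (intro DERIV_add DERIV_const DERIV_radial_potential cont_src r)
  then have "((\<lambda>r. 1 + radial_potential (2 * m + 1) src r) has_real_derivative dv r) (at r)" by simp
  then show ?thesis
    by (rule has_field_derivative_transform_within_open[where S = "{0<..}"])
      (use r v_eq in auto)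
qed

lemma DERIV_dv: "0 < r \<Longrightarrow> (dv has_real_derivative src r - real (2 * m + 1) / r * dv r) (at r)"
  unfolding dv_def by (rule DERIV_radial_flux[OF cont_src])

lemma DERIV_power_dv:
  "0 < r \<Longrightarrow> ((\<lambda>r. r ^ (2 * m + 1) * dv r) has_real_derivative r ^ (2 * m + 1) * src r) (at r)"
  unfolding dv_def by (rule DERIV_power_times_radial_flux[OF cont_src])

lemma DERIV_W: "0 < r \<Longrightarrow> (W has_real_derivative dW r) (at r)"
  unfolding W_def screening_def dW_def by (rule DERIV_radial_potential[OF cont_rhs])

lemma DERIV_W_0: "(W has_real_derivative 0) (at 0 within {0..})"
  using DERIV_radial_potential_within[OF cont_rhs order_refl, of 1]
  by (simp add: W_def screening_def)

lemma DERIV_dW: "0 < r \<Longrightarrow>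
    (dW has_real_derivative \<beta> * r ^ (2 * m) * (clip (v r))\<^sup>2 - dW r / r) (at r)"
  using DERIV_radial_flux[OF cont_rhs, of r 1] by (simp add: dW_def)

lemma DERIV_power_dW:
  "0 < r \<Longrightarrow> ((\<lambda>r. r * dW r) has_real_derivative r * (\<beta> * r ^ (2 * m) * (clip (v r))\<^sup>2)) (at r)"
  using DERIV_power_times_radial_flux[OF cont_rhs, of r 1] by (simp add: dW_def)

lemma cont_dW: "continuous_on {0..} dW"
  unfolding dW_def by (rule continuous_on_radial_flux[OF cont_rhs])

lemma dW_0 [simp]: "dW 0 = 0"
  by (simp add: dW_def)

lemma dW_nonneg: "0 \<le> r \<Longrightarrow> 0 \<le> dW r"
  unfolding dW_def by (rule radial_flux_nonneg[OF cont_rhs]) (use \<beta>_nonneg in auto)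

lemma W_mono:
  assumes "0 \<le> r" "r \<le> s"
  shows "W r \<le> W s"
proof (rule DERIV_nonneg_imp_increasing_open[OF assms(2)])
  show "\<exists>y. (W has_real_derivative y) (at x) \<and> 0 \<le> y" if "r < x" "x < s" for x
    using DERIV_W[of x] dW_nonneg[of x] that assms by fastforce
  show "continuous_on {r..s} W"
    using cont_W by (rule continuous_on_subset) (use assms in auto)
qed

lemma W_nonneg: "0 \<le> r \<Longrightarrow> 0 \<le> W r"
  using W_mono[of 0 r] by simp

lemma v_mono_on:
  assumes "0 \<le> r" "r \<le> s" "\<And>x. r < x \<Longrightarrow> x < s \<Longrightarrow> 0 \<le> dv x"
  shows "v r \<le> v s"
proof (rule DERIV_nonneg_imp_increasing_open[OF assms(2)])
  show "\<exists>y. (v has_real_derivative y) (at x) \<and> 0 \<le> y" if "r < x" "x < s" for x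
    using DERIV_v[of x] assms that by fastforce
  show "continuous_on {r..s} v"
    using cont_v by (rule continuous_on_subset) (use assms in auto)
qed

lemma v_antimono_on:
  assumes "0 \<le> r" "r \<le> s" "\<And>x. r < x \<Longrightarrow> x < s \<Longrightarrow> dv x \<le> 0"
  shows "v s \<le> v r"
proof (rule DERIV_nonpos_imp_decreasing_open[OF assms(2)])
  show "\<exists>y. (v has_real_derivative y) (at x) \<and> y \<le> 0" if "r < x" "x < s" for x
    using DERIV_v[of x] assms that by fastforce
  show "continuous_on {r..s} v"
    using cont_v by (rule continuous_on_subset) (use assms in auto)
qed

lemma power_dv_mono:
  assumes "0 < r" "r \<le> s" "\<And>x. r \<le> x \<Longrightarrow> x \<le> s \<Longrightarrow> 0 \<le> src x"
  shows "r ^ (2 * m + 1) * dv r \<le> s ^ (2 * m + 1) * dv s"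
proof (rule DERIV_nonneg_imp_nondecreasing[OF assms(2)])
  show "\<exists>y. ((\<lambda>r. r ^ (2 * m + 1) * dv r) has_real_derivative y) (at x) \<and> 0 \<le> y"
    if "r \<le> x" "x \<le> s" for x
    using DERIV_power_dv[of x] assms that by (intro exI[of _ "x ^ (2 * m + 1) * src x"]) auto
qed

lemma power_dv_antimono:
  assumes "0 < r" "r \<le> s" "\<And>x. r \<le> x \<Longrightarrow> x \<le> s \<Longrightarrow> src x \<le> 0"
  shows "s ^ (2 * m + 1) * dv s \<le> r ^ (2 * m + 1) * dv r"
proof (rule DERIV_nonpos_imp_nonincreasing[OF assms(2)])
  show "\<exists>y. ((\<lambda>r. r ^ (2 * m + 1) * dv r) has_real_derivative y) (at x) \<and> y \<le> 0"
    if "r \<le> x" "x \<le> s" for x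
    using DERIV_power_dv[of x] assms that
    by (intro exI[of _ "x ^ (2 * m + 1) * src x"]) (auto intro!: mult_nonneg_nonpos)
qed

text \<open>Near the origin \<open>v\<close> is close to 1 and \<open>W\<close> close to 0, so the
  source is strictly negative and so is the flux. As long as \<open>W <= 1\<close> the source stays
  nonpositive and \<open>r ^ (2 * m + 1) * dv r\<close> cannot grow back.\<close>

lemma dv_neg:
  assumes r: "0 < r" and W: "W r \<le> 1"
  shows "dv r < 0"
proof -
  have "\<forall>\<^sub>F x in at 0 within {0..}. v x > 1 / 2 \<and> W x < 1 / 2"
  proof (rule eventually_conj)
    have "(v \<longlongrightarrow> v 0) (at 0 within {0..})" "(W \<longlongrightarrow> W 0) (at 0 within {0..})"
      using cont_v cont_W unfolding continuous_on_def by blast+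
    then show "\<forall>\<^sub>F x in at 0 within {0..}. v x > 1 / 2" "\<forall>\<^sub>F x in at 0 within {0..}. W x < 1 / 2"
      by (auto elim!: order_tendstoD simp del: less_divide_eq_numeral1 divide_less_eq_numeral1)
  qed
  then obtain d where d: "d > 0" "\<And>x. 0 < x \<Longrightarrow> x < d \<Longrightarrow> v x > 1 / 2 \<and> W x < 1 / 2"
    unfolding eventually_at by (auto simp: dist_real_def)
  define e where "e = min r (d / 2)"
  have e: "0 < e" "e \<le> r" "e < d" using d r by (auto simp: e_def)
  have "src x \<le> - (1 / 4)" if "0 \<le> x" "x \<le> e" for x
  proof -
    have "v x > 1 / 2 \<and> W x < 1 / 2" using d(2)[of x] that e by (cases "x = 0") auto
    then have "1 / 2 * (1 / 2) \<le> (1 - W x) * clip (v x)"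
      by (intro mult_mono) (auto simp: clip_def)
    then show ?thesis by (simp add: src_def algebra_simps)
  qed
  then have "dv e \<le> radial_flux (2 * m + 1) (\<lambda>_. - (1 / 4)) e"
    unfolding dv_def by (intro radial_flux_mono cont_src continuous_on_const) (use e in auto)
  also have "\<dots> < 0" using e by (simp add: radial_flux_const)
  finally have "e ^ (2 * m + 1) * dv e < 0" using e by (simp add: mult_pos_neg)
  moreover have "r ^ (2 * m + 1) * dv r \<le> e ^ (2 * m + 1) * dv e"
  proof (rule power_dv_antimono[OF e(1,2)])
    fix x assume "e \<le> x" "x \<le> r"
    then have "W x \<le> 1" using W_mono[of x r] W e by simp
    then show "src x \<le> 0" unfolding src_def by (intro mult_nonpos_nonneg) auto
  qed
  ultimately have "r ^ (2 * m + 1) * dv r < 0" by linarith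
  then show ?thesis using r by (simp add: mult_less_0_iff)
qed

text \<open>By \<open>dv_neg\<close> a positive slope can only occur once \<open>W > 1\<close>.
  Since \<open>W\<close> is monotone, the source is nonnegative from there on and the weighted slope
  does not decrease.\<close>

lemma dv_pos_stays:
  assumes "0 < r" "0 < dv r" "r \<le> s"
  shows "0 < dv s"
proof -
  have W: "1 < W r" using dv_neg[of r] assms by force
  have "r ^ (2 * m + 1) * dv r \<le> s ^ (2 * m + 1) * dv s"
  proof (rule power_dv_mono[OF assms(1,3)])
    fix x assume "r \<le> x" "x \<le> s"
    then have "1 \<le> W x" using W_mono[of r x] W assms by simp
    then show "0 \<le> src x" unfolding src_def by (intro mult_nonneg_nonneg) auto
  qed
  moreover have "0 < r ^ (2 * m + 1) * dv r" using assms by simp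
  ultimately have "0 < s ^ (2 * m + 1) * dv s" by linarith
  moreover have "0 < s ^ (2 * m + 1)" using assms by (intro zero_less_power) simp
  ultimately show ?thesis by (simp only: zero_less_mult_iff) linarith
qed

lemma v_increases_after:
  assumes "0 \<le> s" "s < r" "v s < v r" "r \<le> q"
  shows "v r \<le> v q"
proof -
  obtain x where x: "s < x" "x < r" "0 < dv x"
    using v_antimono_on[of s r] assms by (meson less_imp_le not_le)
  show ?thesis
  proof (rule v_mono_on)
    show "0 \<le> dv y" if "r < y" for y
      using dv_pos_stays[of x y] assms x that by simp
  qed (use assms in auto)
qed

text \<open>
  Where \<open>v \<le> 0\<close> the truncated source vanishes and \<open>r ^ (2 * m + 1) * v'\<close> is constant, so a negative minimum
  can never be left.
\<close>

lemma v_neg_stays: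
  assumes "0 \<le> q" "v q < 0" "q \<le> s"
  shows "v s \<le> 0"
proof (rule ccontr)
  assume "\<not> v s \<le> 0"
  then have s: "v s > 0" by simp
  have cont: "continuous_on {a..b} v" if "0 \<le> a" for a b
    using cont_v by (rule continuous_on_subset) (use that in auto)
  have "\<exists>p\<in>{0..s}. \<forall>x\<in>{0..s}. v p \<le> v x"
    by (rule continuous_attains_inf[OF compact_Icc _ cont]) (use assms in auto)
  then obtain p where p: "p \<in> {0..s}" and min: "\<And>x. x \<in> {0..s} \<Longrightarrow> v p \<le> v x"
    by blast
  have vp: "v p < 0" using min[of q] assms by simp
  then have "p \<noteq> 0" "p \<noteq> s" using s by auto
  then have ps: "0 < p" "p < s" using p by auto
  have "dv p = 0"
  proof (rule DERIV_local_min[OF DERIV_v[OF ps(1)]])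
    show "0 < min p (s - p)" using ps by simp
    show "\<forall>y. \<bar>p - y\<bar> < min p (s - p) \<longrightarrow> v p \<le> v y" using min by (auto simp: abs_if split: if_splits)
  qed
  obtain e where e: "p < e" "e \<le> s" "v e = 0" "\<And>x. p \<le> x \<Longrightarrow> x < e \<Longrightarrow> v x < 0"
    using first_zero[OF cont[of p s]] ps vp s by (metis less_imp_le)
  have src: "src x = 0" if "p \<le> x" "x \<le> e" for x
    using e(3) e(4)[of x] that by (cases "x = e") (auto simp: src_def clip_def)
  have "x ^ (2 * m + 1) * dv x \<le> p ^ (2 * m + 1) * dv p" if "p < x" "x < e" for x
    by (rule power_dv_antimono) (use that ps src in auto)
  then have "dv x \<le> 0" if "p < x" "x < e" for x
  proof -
    have "x ^ (2 * m + 1) * dv x \<le> 0" "0 < x ^ (2 * m + 1)"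
      using \<open>dv p = 0\<close> that ps \<open>\<And>x. p < x \<Longrightarrow> x < e \<Longrightarrow> x ^ (2 * m + 1) * dv x \<le> p ^ (2 * m + 1) * dv p\<close>[of x]
      by (simp_all del: power_Suc)
    then show ?thesis by (simp only: mult_le_0_iff) linarith
  qed
  then have "v e \<le> v p" using v_antimono_on[of p e] e ps by auto
  then show False using e vp by simp
qed

text \<open>Irreversibility decides by the order of the radii: if \<open>v\<close> is negative at
  \<open>q <= r\<close>, it cannot be positive at \<open>r\<close>; if \<open>r < q\<close>, the
  earlier increase forces \<open>v q >= v r > 0\<close>.\<close>

lemma not_neg_and_increasing:
  assumes "0 \<le> q" "v q < 0" "0 \<le> s" "s < r" "0 < v s" "v s < v r"
  shows False
  using v_neg_stays[of q r] v_increases_after[of s r q] assms by (cases "q \<le> r") auto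

section \<open>The two ends of the parameter interval\<close>

lemma profile_increasing_large:
  assumes \<beta>: "\<beta> = 32 * real (2 * m + 2) ^ 2"
  shows "\<exists>s r. 0 \<le> s \<and> s < r \<and> 0 < v s \<and> v s < v r"
proof -
  \<comment> \<open>Origin of \<open>32 * N^2\<close>: on \<open>{0..1}\<close> the source is at
    least -1, so \<open>v >= 1 - r^2 / 2 >= 1 / 2\<close> and
    \<open>W >= \<beta> / (4 * N^2) * r ^ (2 * m + 2)\<close>, whose coefficient is 8. The source is
    then at least \<open>4 * s ^ (2 * m + 2) - 1\<close>, and its flux at 1 is
    \<open>4 / (2 * N) - 1 / N = 1 / N > 0\<close>.\<close>
  define N where "N = real (2 * m + 2)"
  have N: "N > 0" by (simp add: N_def)
  have v: "1 / 2 \<le> v r" if r: "0 \<le> r" "r \<le> 1" for r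
  proof -
    have "v 0 + 0\<^sup>2 / 2 \<le> v r + r\<^sup>2 / 2"
    proof (rule DERIV_nonneg_imp_increasing_open[OF r(1)])
      show "continuous_on {0..r} (\<lambda>r. v r + r\<^sup>2 / 2)"
        by (intro continuous_intros continuous_on_subset[OF cont_v]) auto
      fix x assume x: "0 < x" "x < r"
      have "radial_flux (2 * m + 1) (\<lambda>_. - 1) x \<le> dv x"
        unfolding dv_def
      proof (intro radial_flux_mono cont_src continuous_on_const)
        fix s assume "0 \<le> s" "s \<le> x"
        then have "0 \<le> W s * clip (v s)" using W_nonneg by simp
        then show "- 1 \<le> src s" using clip_le_1[of "v s"] unfolding src_def left_diff_distrib by linarith
      qed (use x in auto)
      moreover have "x / N \<le> x / 1"
        using x by (intro divide_left_mono) (auto simp: N_def)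
      ultimately have "0 \<le> dv x + x" using x by (simp add: radial_flux_const N_def)
      moreover have "((\<lambda>r. v r + r\<^sup>2 / 2) has_real_derivative dv x + x) (at x)"
        by (rule DERIV_add[OF DERIV_v]) (use x in \<open>auto intro!: derivative_eq_intros\<close>)
      ultimately show "\<exists>y. ((\<lambda>r. v r + r\<^sup>2 / 2) has_real_derivative y) (at x) \<and> 0 \<le> y" by blast
    qed
    moreover have "r\<^sup>2 \<le> 1" using r by (simp add: power_le_one)
    ultimately show ?thesis by simp
  qed
  have W: "8 * r ^ (2 * m + 2) \<le> W r" if r: "0 \<le> r" "r \<le> 1" for r
  proof -
    have "W 0 - 8 * 0 ^ (2 * m + 2) \<le> W r - 8 * r ^ (2 * m + 2)"
    proof (rule DERIV_nonneg_imp_increasing_open[OF r(1)])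
      show "continuous_on {0..r} (\<lambda>r. W r - 8 * r ^ (2 * m + 2))"
        by (intro continuous_intros continuous_on_subset[OF cont_W]) auto
      fix x assume x: "0 < x" "x < r"
      have "radial_flux 1 (\<lambda>s. (\<beta> / 4) * s ^ (2 * m)) x \<le> dW x"
        unfolding dW_def
      proof (intro radial_flux_mono cont_rhs)
        fix s assume s: "0 \<le> s" "s \<le> x"
        have "(1 / 2)\<^sup>2 \<le> (clip (v s))\<^sup>2"
          using v[of s] s x r by (intro power_mono) (auto simp: clip_def)
        then have "\<beta> * s ^ (2 * m) * (1 / 2)\<^sup>2 \<le> \<beta> * s ^ (2 * m) * (clip (v s))\<^sup>2"
          using \<beta>_nonneg s by (intro mult_left_mono) auto
        then show "(\<beta> / 4) * s ^ (2 * m) \<le> \<beta> * s ^ (2 * m) * (clip (v s))\<^sup>2"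
          by (simp add: power2_eq_square)
      qed (use x in \<open>auto intro!: continuous_intros\<close>)
      also have "radial_flux 1 (\<lambda>s. (\<beta> / 4) * s ^ (2 * m)) x = (\<beta> / 4) * x ^ (2 * m + 1) / N"
        using x by (subst radial_flux_power) (auto simp: N_def)
      also have "\<dots> = 8 * N * x ^ (2 * m + 1)"
        unfolding \<beta> N_def[symmetric] using N by (simp add: power2_eq_square)
      finally have "0 \<le> dW x - 8 * (N * x ^ (2 * m + 1))" by simp
      moreover have "((\<lambda>r. W r - 8 * r ^ (2 * m + 2)) has_real_derivative dW x - 8 * (N * x ^ (2 * m + 1))) (at x)"
        using DERIV_diff[OF DERIV_W[OF x(1)] DERIV_cmult[OF DERIV_pow[of "2 * m + 2" x UNIV], of 8]]
        by (simp add: N_def)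
      ultimately show "\<exists>y. ((\<lambda>r. W r - 8 * r ^ (2 * m + 2)) has_real_derivative y) (at x) \<and> 0 \<le> y" by blast
    qed
    then show ?thesis by simp
  qed
  have "radial_flux (2 * m + 1) (\<lambda>s. 4 * s ^ (2 * m + 2) - 1 * s ^ 0) 1 \<le> dv 1"
    unfolding dv_def
  proof (intro radial_flux_mono cont_src)
    fix s :: real assume s: "0 \<le> s" "s \<le> 1"
    have "(8 * s ^ (2 * m + 2)) * (1 / 2) \<le> W s * clip (v s)"
      by (intro mult_mono W) (use v[of s] s in \<open>auto simp: clip_def W_nonneg\<close>)
    then show "4 * s ^ (2 * m + 2) - 1 * s ^ 0 \<le> src s"
      using clip_le_1[of "v s"] unfolding src_def left_diff_distrib power_0 by linarith
  qed (auto intro!: continuous_intros)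
  also have "radial_flux (2 * m + 1) (\<lambda>s. 4 * s ^ (2 * m + 2) - 1 * s ^ 0) 1 = 4 / (2 * N) - 1 / N"
  proof -
    have "radial_flux (2 * m + 1) (\<lambda>s. 4 * s ^ (2 * m + 2) - 1 * s ^ 0) 1
        = radial_flux (2 * m + 1) (\<lambda>s. 4 * s ^ (2 * m + 2)) 1 - radial_flux (2 * m + 1) (\<lambda>s. 1 * s ^ 0) 1"
      by (intro radial_flux_diff continuous_intros) auto
    also have "\<dots> = 4 / (2 * N) - 1 / N"
      unfolding radial_flux_power[OF zero_le_one] by (simp add: N_def algebra_simps)
    finally show ?thesis .
  qed
  also have "4 / (2 * N) - 1 / N = 1 / N" using N by (simp add: field_simps)
  finally have "1 / N \<le> dv 1" .
  moreover have "0 < 1 / N" using N by simp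
  ultimately have "0 < dv 1" by linarith
  from DERIV_pos_inc_left[OF DERIV_v[OF zero_less_one] this]
  obtain d where d: "d > 0" "\<And>h. h > 0 \<Longrightarrow> h < d \<Longrightarrow> v (1 - h) < v 1" by auto
  \<comment> \<open>The cap at 1 keeps \<open>1 - h\<close> in \<open>{0..1}\<close>, where
    \<open>v >= 1 / 2\<close> supplies the positivity required at the left point.\<close>
  define h where "h = min (d / 2) 1"
  have "0 < h" "h < d" "h \<le> 1" using d by (auto simp: h_def)
  with d v[of "1 - h"] show ?thesis
    by (intro exI[of _ "1 - h"] exI[of _ 1]) auto
qed

text \<open>Without screening, a profile that stays nonnegative solves
  \<open>v'' + ((2 * m + 1) / r) * v' = - v\<close>, whose regular solution is a multiple of
  \<open>r^(-m)\<close> times the Bessel function of order \<open>m\<close> and therefore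
  oscillates. The contradiction is obtained without Bessel functions.\<close>

lemma profile_negative_zero:
  assumes \<beta>: "\<beta> = 0"
  shows "\<exists>r\<ge>0. v r < 0"
proof (rule ccontr)
  assume "\<not> ?thesis"
  then have nonneg: "0 \<le> v r" if "r \<ge> 0" for r using that by force
  have W: "W r = 0" if "r \<ge> 0" for r
  proof -
    have "W r = screening m \<beta> v r" by (simp only: W_def)
    also have "\<dots> = 0"
      using abs_radial_potential_le_const[of "\<lambda>_. 0" r 0 1] that unfolding screening_def
      by (simp add: \<beta>)
    finally show ?thesis .
  qed
  have dv: "dv r < 0" if "r > 0" for r using dv_neg[of r] W that by simp
  have pos: "0 < v r" if "r > 0" for r
  proof -
    have "v (r + 1) < v r"
    proof (rule DERIV_neg_imp_decreasing[where f = v])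
      show "\<exists>y. (v has_real_derivative y) (at x) \<and> y < 0" if "r \<le> x" for x
        using DERIV_v[of x] dv[of x] that \<open>r > 0\<close> by force
    qed simp
    then show ?thesis using nonneg[of "r + 1"] that by simp
  qed
  have le1: "v r \<le> 1" if "r \<ge> 0" for r
    using v_antimono_on[of 0 r] that dv by (auto intro: less_imp_le)
  txt \<open>The Riccati variable \<open>z = - v' / v\<close> satisfies \<open>z' = 1 - (a / r) * z + z\<^sup>2\<close>, which blows up in finite time.\<close>
  define z where "z r = - dv r / v r" for r
  define a where "a = real (2 * m + 1)"
  have a: "a \<ge> 1" by (simp add: a_def)
  \<comment> \<open>For \<open>r >= a\<close> and \<open>z >= 0\<close> the derivative of
    \<open>z\<close> is at least \<open>1 - z + z^2 >= (1 + z^2) / 2\<close>, so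
    \<open>arctan z\<close> rises at rate at least 1/2. Over length 8 it gains 4, more than the
    width \<open>pi\<close> of its range.\<close>
  have "arctan (z a) - a / 2 \<le> arctan (z (a + 8)) - (a + 8) / 2"
  proof (rule DERIV_nonneg_imp_nondecreasing[where f = "\<lambda>r. arctan (z r) - r / 2"])
    fix r assume r: "a \<le> r" "r \<le> a + 8"
    then have r0: "r > 0" using a by simp
    have "src r = - v r"
      using W[of r] le1[of r] pos[of r] r0 by (simp add: src_def clip_def)
    then have "(dv has_real_derivative - v r - a / r * dv r) (at r)"
      using DERIV_dv[OF r0] by (simp add: a_def)
    then have "(z has_real_derivative (- (- v r - a / r * dv r) * v r - (- dv r) * dv r) / (v r * v r)) (at r)"
      unfolding z_def using pos[OF r0] DERIV_v[OF r0] by (intro DERIV_divide DERIV_minus) auto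
    moreover have "(- (- v r - a / r * dv r) * v r - (- dv r) * dv r) / (v r * v r) = 1 - a / r * z r + (z r)\<^sup>2"
    proof -
      have "(- (- V - c * d) * V - (- d) * d) / (V * V) = 1 - c * (- d / V) + (- d / V)\<^sup>2"
        if "V > 0" for V c d :: real
        using that by (simp add: add_divide_distrib power2_eq_square distrib_right)
      from this[OF pos[OF r0], of "a / r" "dv r"] show ?thesis by (simp only: z_def)
    qed
    ultimately have "(z has_real_derivative 1 - a / r * z r + (z r)\<^sup>2) (at r)" by simp
    then have "((\<lambda>r. arctan (z r) - r / 2) has_real_derivative
        inverse (1 + (z r)\<^sup>2) * (1 - a / r * z r + (z r)\<^sup>2) - 1 / 2) (at r)"
      by (intro DERIV_diff DERIV_chain2[OF DERIV_arctan] DERIV_cdivide DERIV_ident)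
    moreover have "0 \<le> inverse (1 + (z r)\<^sup>2) * (1 - a / r * z r + (z r)\<^sup>2) - 1 / 2"
    proof -
      have "0 \<le> z r" using dv[OF r0] pos[OF r0] by (simp add: z_def divide_nonpos_pos)
      define c where "c = a / r * z r"
      have "c \<le> 1 * z r" using r r0 \<open>0 \<le> z r\<close> unfolding c_def by (intro mult_right_mono) auto
      moreover have "0 \<le> 1 - 2 * z r + (z r)\<^sup>2"
        using zero_le_power2[of "1 - z r"] by (simp add: power2_diff)
      ultimately have "(1 + (z r)\<^sup>2) / 2 \<le> 1 - c + (z r)\<^sup>2"
        by (simp add: field_simps)
      moreover have "0 < 1 + (z r)\<^sup>2" by (simp add: add_pos_nonneg)
      ultimately show ?thesis unfolding c_def[symmetric] by (simp add: field_simps)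
    qed
    ultimately show "\<exists>y. ((\<lambda>r. arctan (z r) - r / 2) has_real_derivative y) (at r) \<and> 0 \<le> y" by blast
  qed simp
  moreover have "(a + 8) / 2 = a / 2 + 4" by simp
  ultimately show False
    using arctan_lbound[of "z a"] arctan_ubound[of "z (a + 8)"] pi_less_4 by linarith
qed

end

section \<open>Existence\<close>

text \<open>The two assumptions say that \<open>\<beta>\<close> avoids both open parameter
  sets.\<close>

locale critical_profile = shooting_profile +
  assumes nonneg: "\<And>r. 0 \<le> r \<Longrightarrow> 0 \<le> v r"
    and not_increasing: "\<And>s r. 0 \<le> s \<Longrightarrow> s < r \<Longrightarrow> 0 < v s \<Longrightarrow> v r \<le> v s"
begin

text \<open>A first zero would be a minimum of the nonnegative \<open>v\<close>, so \<open>v\<close>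
  and its slope would vanish together. Uniqueness for the second-order equation, run backwards on an
  interval away from the singular origin, would then make \<open>v\<close> vanish earlier.\<close>

lemma v_pos:
  assumes r: "0 \<le> r"
  shows "0 < v r"
proof (rule ccontr)
  assume "\<not> 0 < v r"
  then have "0 \<le> - v r" by simp
  moreover have "continuous_on {0..r} (\<lambda>x. - v x)"
    by (intro continuous_intros continuous_on_subset[OF cont_v]) auto
  ultimately obtain e where e: "0 < e" "- v e = 0" "\<And>x. 0 \<le> x \<Longrightarrow> x < e \<Longrightarrow> - v x < 0"
    using first_zero[of 0 r "\<lambda>x. - v x"] r by auto
  have "dv e = 0"
    by (rule DERIV_local_min[OF DERIV_v[OF e(1)] e(1)]) (use e nonneg in auto)
  define s where "s = e / 2"
  have s: "0 < s" "s < e" using e by (auto simp: s_def)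
  define n where "n = real (2 * m + 1)"
  have n: "0 \<le> n" by (simp add: n_def)
  txt \<open>Backward Gronwall for \<open>v\<^sup>2 + v'\<^sup>2\<close>, which vanishes at a first zero because \<open>v'\<close> does.\<close>
  define K where "K = 1 + W e"
  \<comment> \<open>The three summands absorb the three parts of the derivative of
    \<open>v^2 + dv^2\<close>: 1 for \<open>2 * v * dv\<close>, \<open>K\<close> for the source
    since \<open>|W - 1| <= 1 + W e\<close>, and \<open>2 * n / s\<close> for the damping term on
    \<open>x >= s\<close>.\<close>
  define L where "L = 1 + K + 2 * n / s"
  define f where "f x = ((v x)\<^sup>2 + (dv x)\<^sup>2) * exp (L * x)" for x
  have "f s \<le> f e"
  proof (rule DERIV_nonneg_imp_nondecreasing[where f = f])
    fix x assume x: "s \<le> x" "x \<le> e"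
    then have x0: "0 < x" using s by simp
    define E' where "E' = 2 * v x * dv x + 2 * dv x * (src x - n / x * dv x)"
    have "((\<lambda>x. (v x)\<^sup>2 + (dv x)\<^sup>2) has_real_derivative E') (at x)"
      unfolding E'_def n_def
      by (rule derivative_eq_intros DERIV_v DERIV_dv x0 refl | simp)+
    then have "(f has_real_derivative (((v x)\<^sup>2 + (dv x)\<^sup>2) * (exp (L * x) * L) + E' * exp (L * x))) (at x)"
      unfolding f_def
      by (intro DERIV_mult' DERIV_fun_exp) (auto intro!: derivative_eq_intros)
    moreover have "0 \<le> ((v x)\<^sup>2 + (dv x)\<^sup>2) * (exp (L * x) * L) + E' * exp (L * x)"
    proof -
      have "0 \<le> W x" "W x \<le> W e" using W_nonneg W_mono x x0 by auto
      then have K: "\<bar>W x - 1\<bar> \<le> K" "0 \<le> K" by (auto simp: K_def)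
      have sq: "\<bar>2 * a * b\<bar> \<le> a\<^sup>2 + b\<^sup>2" for a b :: real
        using zero_le_power2[of "a + b"] zero_le_power2[of "a - b"]
        by (simp add: power2_sum power2_diff abs_le_iff)
      have "\<bar>2 * dv x * src x\<bar> = \<bar>W x - 1\<bar> * \<bar>2 * dv x * clip (v x)\<bar>"
        by (simp add: src_def abs_mult)
      also have "\<dots> \<le> K * ((dv x)\<^sup>2 + (clip (v x))\<^sup>2)"
        by (intro mult_mono K sq) auto
      also have "\<dots> \<le> K * ((dv x)\<^sup>2 + (v x)\<^sup>2)"
        using abs_clip_le[of "v x"] K by (intro mult_left_mono add_left_mono) (simp_all only: abs_le_square_iff)
      finally have 1: "\<bar>2 * dv x * src x\<bar> \<le> K * ((v x)\<^sup>2 + (dv x)\<^sup>2)" by (simp add: add.commute)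
      have "n / x * (dv x)\<^sup>2 \<le> n / s * ((v x)\<^sup>2 + (dv x)\<^sup>2)"
        by (intro mult_mono divide_left_mono) (use n x s in auto)
      then have "2 * (n / x * (dv x)\<^sup>2) \<le> 2 * (n / s * ((v x)\<^sup>2 + (dv x)\<^sup>2))" by simp
      then have 2: "2 * dv x * (n / x * dv x) \<le> 2 * n / s * ((v x)\<^sup>2 + (dv x)\<^sup>2)"
        by (simp add: power2_eq_square mult_ac)
      have "2 * dv x * (src x - n / x * dv x) = 2 * dv x * src x - 2 * dv x * (n / x * dv x)"
        by (simp only: right_diff_distrib)
      with 1 2 sq[of "v x" "dv x"] have "0 \<le> E' + (((v x)\<^sup>2 + (dv x)\<^sup>2) + K * ((v x)\<^sup>2 + (dv x)\<^sup>2)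
          + 2 * n / s * ((v x)\<^sup>2 + (dv x)\<^sup>2))"
        unfolding E'_def by linarith
      also have "\<dots> = E' + L * ((v x)\<^sup>2 + (dv x)\<^sup>2)"
        unfolding L_def by (simp only: distrib_right mult_1_left)
      finally have "0 \<le> (E' + L * ((v x)\<^sup>2 + (dv x)\<^sup>2)) * exp (L * x)" by simp
      then show ?thesis by (simp add: algebra_simps)
    qed
    ultimately show "\<exists>y. (f has_real_derivative y) (at x) \<and> 0 \<le> y" by blast
  qed (use s in simp)
  then have "((v s)\<^sup>2 + (dv s)\<^sup>2) * exp (L * s) \<le> 0"
    using e \<open>dv e = 0\<close> by (simp add: f_def)
  then have "(v s)\<^sup>2 + (dv s)\<^sup>2 \<le> 0"
    by (simp add: mult_le_0_iff)
  then have "v s = 0" by (simp add: sum_power2_le_zero_iff)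
  then show False using e(3)[of s] s by simp
qed

lemma v_antimono: "0 \<le> s \<Longrightarrow> s \<le> r \<Longrightarrow> v r \<le> v s"
  using not_increasing[of s r] v_pos[of s] by (cases "s = r") auto

lemma v_le_1: "0 \<le> r \<Longrightarrow> v r \<le> 1"
  using v_antimono[of 0 r] by simp

lemma clip_v [simp]: "0 \<le> r \<Longrightarrow> clip (v r) = v r"
  using v_le_1[of r] v_pos[of r] by (simp add: clip_def)

lemma \<beta>_pos: "0 < \<beta>"
proof (rule ccontr)
  assume "\<not> 0 < \<beta>"
  then have "\<beta> = 0" using \<beta>_nonneg by linarith
  then obtain r where "0 \<le> r" "v r < 0" using profile_negative_zero by blast
  then show False using nonneg[of r] by linarith
qed

lemma dv_nonpos: "0 < r \<Longrightarrow> dv r \<le> 0"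
proof (rule ccontr)
  assume r: "0 < r" and "\<not> dv r \<le> 0"
  then obtain d where d: "d > 0" "\<And>h. h > 0 \<Longrightarrow> h < d \<Longrightarrow> v r < v (r + h)"
    using DERIV_pos_inc_right[OF DERIV_v[OF r]] by auto
  have "v r < v (r + d / 2)" by (rule d(2)) (use d in auto)
  then show False using v_antimono[of r "r + d / 2"] r d(1) by simp
qed

text \<open>\<open>r * dW r\<close> is nondecreasing and positive at 1, hence
  \<open>dW r >= c / r\<close> and \<open>W\<close> grows at least like \<open>c * ln r\<close>.
  Level 2 makes the factor \<open>W - 1\<close> in the source at least 1.\<close>

lemma W_eventually_ge_2: "\<exists>R\<ge>1. 2 \<le> W R"
proof -
  define c where "c = dW 1"
  have "radial_flux 1 (\<lambda>s. (\<beta> * (v 1)\<^sup>2) * s ^ (2 * m)) 1 \<le> dW 1"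
    unfolding dW_def
  proof (rule radial_flux_mono)
    fix s :: real assume s: "0 \<le> s" "s \<le> 1"
    have "\<beta> * s ^ (2 * m) * (v 1)\<^sup>2 \<le> \<beta> * s ^ (2 * m) * (v s)\<^sup>2"
      using s \<beta>_nonneg v_antimono[of s 1] v_pos[of 1]
      by (intro mult_left_mono power_mono) auto
    then show "(\<beta> * (v 1)\<^sup>2) * s ^ (2 * m) \<le> \<beta> * s ^ (2 * m) * (clip (v s))\<^sup>2"
      using s by (simp add: mult_ac)
  qed (auto intro!: continuous_intros cont_v)
  moreover have "0 < (\<beta> * (v 1)\<^sup>2) * 1 ^ Suc (2 * m) / real (1 + 2 * m + 1)"
    using \<beta>_pos v_pos[of 1] by simp
  ultimately have c: "0 < c"
    unfolding radial_flux_power[OF zero_le_one] c_def by linarith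
  have dW: "c / r \<le> dW r" if "1 \<le> r" for r
  proof -
    have "1 * dW 1 \<le> r * dW r"
    proof (rule DERIV_nonneg_imp_nondecreasing[OF that, where f = "\<lambda>r. r * dW r"])
      fix x :: real assume "1 \<le> x"
      then show "\<exists>y. ((\<lambda>r. r * dW r) has_real_derivative y) (at x) \<and> 0 \<le> y"
        using DERIV_power_dW[of x] \<beta>_nonneg
        by (intro exI[of _ "x * (\<beta> * x ^ (2 * m) * (clip (v x))\<^sup>2)"]) auto
    qed
    then show ?thesis using that by (simp add: c_def field_simps)
  qed
  define R where "R = exp (2 / c)"
  have R: "1 \<le> R" using c by (simp add: R_def)
  have "W 1 - c * ln 1 \<le> W R - c * ln R"
  proof (rule DERIV_nonneg_imp_nondecreasing[OF R, where f = "\<lambda>r. W r - c * ln r"])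
    fix x :: real assume x: "1 \<le> x"
    have "((\<lambda>r. W r - c * ln r) has_real_derivative dW x - c * (1 / x)) (at x)"
      by (intro DERIV_diff DERIV_W DERIV_cmult DERIV_ln_divide) (use x in auto)
    then show "\<exists>y. ((\<lambda>r. W r - c * ln r) has_real_derivative y) (at x) \<and> 0 \<le> y"
      using dW[OF x] by auto
  qed
  then have "2 \<le> W R"
    using W_nonneg[of 1] c by (simp add: R_def)
  with R show ?thesis by blast
qed

text \<open>Integrate \<open>(t ^ (2 * m + 1) * dv t)' >= r ^ (2 * m + 1) * v (2 * r)\<close> over
  \<open>{r..2 * r}\<close>. The weighted slope is nonpositive at the right end and at least its
  value at \<open>R\<close> at the left end, so its total gain is at most \<open>C\<close>.\<close>

lemma v_decay:
  obtains R C where "1 \<le> R" "0 \<le> C" "\<And>r. R \<le> r \<Longrightarrow> r ^ (2 * m + 2) * v (2 * r) \<le> C"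
proof -
  obtain R where R: "1 \<le> R" "2 \<le> W R" using W_eventually_ge_2 by blast
  have src: "v x \<le> src x" if "R \<le> x" for x
  proof -
    have "1 \<le> W x - 1" using W_mono[of R x] R that by simp
    then have "1 * v x \<le> (W x - 1) * v x"
      using v_pos[of x] R that by (intro mult_right_mono) auto
    then show ?thesis using R that by (simp add: src_def)
  qed
  define C where "C = - (R ^ (2 * m + 1) * dv R)"
  have "r ^ (2 * m + 2) * v (2 * r) \<le> C" if r: "R \<le> r" for r
  proof -
    let ?f = "\<lambda>t. t ^ (2 * m + 1) * dv t - r ^ (2 * m + 1) * v (2 * r) * t"
    have "?f r \<le> ?f (2 * r)"
    proof (rule DERIV_nonneg_imp_nondecreasing[where f = ?f])
      fix t assume t: "r \<le> t" "t \<le> 2 * r"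
      then have t0: "0 < t" using r R by simp
      have "(?f has_real_derivative t ^ (2 * m + 1) * src t - r ^ (2 * m + 1) * v (2 * r)) (at t)"
        by (intro DERIV_diff DERIV_power_dv t0 DERIV_cmult_Id)
      moreover have "r ^ (2 * m + 1) * v (2 * r) \<le> t ^ (2 * m + 1) * src t"
      proof (intro mult_mono power_mono)
        show "v (2 * r) \<le> src t"
          using src[of t] v_antimono[of t "2 * r"] t t0 r by linarith
      qed (use t r R v_pos[of "2 * r"] t0 in auto)
      ultimately show "\<exists>y. (?f has_real_derivative y) (at t) \<and> 0 \<le> y" by auto
    qed (use r R in auto)
    moreover have "(2 * r) ^ (2 * m + 1) * dv (2 * r) \<le> 0"
      using dv_nonpos[of "2 * r"] r R by (intro mult_nonneg_nonpos) auto
    moreover have "R ^ (2 * m + 1) * dv R \<le> r ^ (2 * m + 1) * dv r"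
    proof (rule power_dv_mono)
      fix x assume "R \<le> x" "x \<le> r"
      then show "0 \<le> src x" using src[of x] v_pos[of x] R by simp
    qed (use R r in auto)
    moreover have "r ^ (2 * m + 2) * v (2 * r)
        = r ^ (2 * m + 1) * v (2 * r) * (2 * r) - r ^ (2 * m + 1) * v (2 * r) * r"
      by simp
    ultimately show ?thesis unfolding C_def by linarith
  qed
  moreover have "0 \<le> C"
    using dv_nonpos[of R] R by (simp add: C_def mult_nonneg_nonpos)
  ultimately show thesis using that R by blast
qed

section \<open>The solution built from a critical profile\<close>

definition u :: "real \<Rightarrow> real" where
  "u r = sqrt \<beta> * r ^ m * v r"

lemma u_tendsto_0: "(u \<longlongrightarrow> 0) at_top"
proof -
  obtain R C where R: "1 \<le> R" and C: "0 \<le> C" and le: "\<And>r. R \<le> r \<Longrightarrow> r ^ (2 * m + 2) * v (2 * r) \<le> C"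
    using v_decay by blast
  \<comment> \<open>With \<open>x = 2 * r\<close>, the factor \<open>2 ^ m\<close> comes from
    \<open>x ^ m\<close> and the final 2 from \<open>C / r = 2 * C / x\<close>.\<close>
  define K where "K = sqrt \<beta> * 2 ^ m * C * 2"
  have "norm (u x) \<le> K / x" if x: "2 * R \<le> x" for x
  proof -
    define r where "r = x / 2"
    have r: "R \<le> r" "x = 2 * r" using x by (auto simp: r_def)
    have vr: "0 < v (2 * r)" using v_pos r R by simp
    have "r ^ m * v (2 * r) * r \<le> r ^ m * v (2 * r) * r ^ (m + 2)"
    proof (rule mult_left_mono)
      show "r \<le> r ^ (m + 2)" using power_increasing[of 1 "m + 2" r] r R by (simp only: power_one_right)
      show "0 \<le> r ^ m * v (2 * r)" using vr r R by simp
    qed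
    also have "\<dots> = r ^ (2 * m + 2) * v (2 * r)"
    proof -
      have e: "2 * m + 2 = m + (m + 2)" by simp
      show ?thesis unfolding e power_add[of r m "m + 2"] by (simp only: mult.assoc mult.commute[of "v (2 * r)"])
    qed
    also have "\<dots> \<le> C" using r by (intro le)
    finally have "r ^ m * v (2 * r) \<le> C / r" using r R by (simp add: pos_le_divide_eq)
    then have "sqrt \<beta> * 2 ^ m * (r ^ m * v (2 * r)) \<le> sqrt \<beta> * 2 ^ m * (C / r)"
      using \<beta>_nonneg by (intro mult_left_mono) auto
    moreover have "sqrt \<beta> * 2 ^ m * (r ^ m * v (2 * r)) = u x"
      by (simp add: u_def r power_mult_distrib)
    moreover have "sqrt \<beta> * 2 ^ m * (C / r) = K / x" using r R by (simp add: K_def)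
    moreover have "0 \<le> u x" using \<beta>_nonneg vr r R by (simp add: u_def)
    ultimately show ?thesis by simp
  qed
  then have "\<forall>\<^sub>F x in at_top. norm (u x) \<le> K / x"
    by (auto simp: eventually_at_top_linorder)
  moreover have "((\<lambda>x. K / x) \<longlongrightarrow> 0) at_top"
    by (rule tendsto_divide_0[OF tendsto_const filterlim_at_top_imp_at_infinity[OF filterlim_ident]])
  ultimately show ?thesis by (rule Lim_null_comparison)
qed

lemma radial_solution_critical: "radial_solution m u W"
proof -
  define u' where "u' r = sqrt \<beta> * r ^ m * (real m * v r / r + dv r)" for r
  define u'' where "u'' r = real m * (sqrt \<beta> * r ^ m) / r * (real m * v r / r + dv r)
      + sqrt \<beta> * r ^ m * (real m * (dv r / r - v r / r\<^sup>2) + (src r - real (2 * m + 1) / r * dv r))" for r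
  have pow: "((\<lambda>r. sqrt \<beta> * r ^ m) has_real_derivative real m * (sqrt \<beta> * r ^ m) / r) (at r)"
    if "0 < r" for r
  proof -
    have "((\<lambda>r. sqrt \<beta> * r ^ m) has_real_derivative sqrt \<beta> * (real m * r ^ (m - Suc 0))) (at r)"
      by (intro DERIV_cmult DERIV_pow)
    moreover have "real m * r ^ (m - Suc 0) = real m * r ^ m / r"
      using that by (cases m) auto
    ultimately show ?thesis by (simp add: mult_ac)
  qed
  have u1: "(u has_real_derivative u' r) (at r)" if r: "0 < r" for r
  proof -
    have "(u has_real_derivative sqrt \<beta> * r ^ m * dv r + real m * (sqrt \<beta> * r ^ m) / r * v r) (at r)"
      unfolding u_def by (intro DERIV_mult' pow DERIV_v r)
    then show ?thesis by (simp add: u'_def algebra_simps)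
  qed
  have u2: "(u' has_real_derivative u'' r) (at r)" if r: "0 < r" for r
  proof -
    have "((\<lambda>r. real m * v r / r + dv r) has_real_derivative
        (real m * dv r * r - real m * v r * 1) / (r * r) + (src r - real (2 * m + 1) / r * dv r)) (at r)"
      by (intro DERIV_add DERIV_divide DERIV_cmult DERIV_ident DERIV_v DERIV_dv r) (use r in auto)
    moreover have "(real m * dv r * r - real m * v r * 1) / (r * r) = real m * (dv r / r - v r / r\<^sup>2)"
      using r by (simp add: field_simps power2_eq_square)
    ultimately have "((\<lambda>r. real m * v r / r + dv r) has_real_derivative
        real m * (dv r / r - v r / r\<^sup>2) + (src r - real (2 * m + 1) / r * dv r)) (at r)" by simp
    from DERIV_mult'[OF pow[OF r] this] show ?thesis
      unfolding u'_def u''_def by (simp add: add.commute)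
  qed
  have du: "deriv u r = u' r" if "0 < r" for r
    using u1[OF that] by (rule DERIV_imp_deriv)
  have dW': "deriv W r = dW r" if "0 < r" for r
    using DERIV_W[OF that] by (rule DERIV_imp_deriv)
  have ddu: "(deriv u has_real_derivative u'' r) (at r)" if "0 < r" for r
    using u2[OF that] by (rule has_field_derivative_transform_within_open[where S = "{0<..}"])
      (use that du in auto)
  have ddW: "(deriv W has_real_derivative \<beta> * r ^ (2 * m) * (clip (v r))\<^sup>2 - dW r / r) (at r)" if "0 < r" for r
    using DERIV_dW[OF that] by (rule has_field_derivative_transform_within_open[where S = "{0<..}"])
      (use that dW' in auto)
  have ode: "u'' r + u' r / r - (real m)\<^sup>2 / r\<^sup>2 * u r = (W r - 1) * u r" if r: "0 < r" for r
  proof -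
    \<comment> \<open>Naming \<open>r ^ m\<close> and \<open>1 / r\<close> as opaque quantities
      turns the equation into a polynomial identity.\<close>
    define g where "g = sqrt \<beta> * r ^ m"
    define i where "i = 1 / r"
    have "u'' r + u' r / r - (real m)\<^sup>2 / r\<^sup>2 * u r
        = real m * g * i * (real m * v r * i + dv r)
      + g * (real m * (dv r * i - v r * i\<^sup>2) + (src r - real (2 * m + 1) * i * dv r))
      + g * (real m * v r * i + dv r) * i - (real m)\<^sup>2 * i\<^sup>2 * (g * v r)"
      by (simp add: u''_def u'_def u_def g_def i_def power_divide)
    also have "\<dots> = g * src r"
      by (simp add: algebra_simps power2_eq_square)
    also have "\<dots> = (W r - 1) * u r" using r by (simp add: g_def src_def u_def)
    finally show ?thesis .
  qed
  have u_sq: "\<bar>u r\<bar>\<^sup>2 = \<beta> * r ^ (2 * m) * (clip (v r))\<^sup>2" if "0 < r" for r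
    using that \<beta>_nonneg by (simp add: u_def power_mult_distrib power_mult[symmetric] mult.commute)
  have "(dW \<longlongrightarrow> 0) (at_right 0)"
  proof -
    have "(dW \<longlongrightarrow> dW 0) (at 0 within {0..})" using cont_dW unfolding continuous_on_def by blast
    then have "(dW \<longlongrightarrow> dW 0) (at_right 0)" by (rule tendsto_within_subset) auto
    then show ?thesis by simp
  qed
  then have lim: "(deriv W \<longlongrightarrow> 0) (at_right 0)"
    by (rule Lim_transform_eventually) (use dW' in \<open>auto simp: eventually_at_filter\<close>)
  show ?thesis
    unfolding radial_solution_def
  proof (intro conjI allI impI)
    fix r :: real assume r: "0 < r"
    show "u differentiable at r" "deriv u differentiable at r" "W differentiable at r"
      "deriv W differentiable at r"
      using u1[OF r] ddu[OF r] DERIV_W[OF r] ddW[OF r] by (auto simp: real_differentiable_def)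
    show "deriv (deriv u) r + deriv u r / r - (real m)\<^sup>2 / r\<^sup>2 * u r = (W r - 1) * u r"
      using ode[OF r] DERIV_imp_deriv[OF ddu[OF r]] du[OF r] by simp
    show "deriv (deriv W) r + deriv W r / r = \<bar>u r\<bar>\<^sup>2"
      using u_sq[OF r] DERIV_imp_deriv[OF ddW[OF r]] dW'[OF r] by simp
    show "0 < u r" using r \<beta>_pos v_pos[of r] by (simp add: u_def)
  next
    show "continuous_on {0..} u"
      unfolding u_def by (intro continuous_intros cont_v)
  qed (use cont_W DERIV_W_0 lim u_tendsto_0 in auto)
qed

end

section \<open>Selecting the parameter by connectedness\<close>

lemma critical_profile_exists: "\<exists>\<beta>. critical_profile m \<beta>"
proof -
  define b where "b = 32 * real (2 * m + 2) ^ 2"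
  define S where "S = {0..b}"
  define A where "A r = {\<beta> \<in> S. shooting m \<beta> r < 0}" for r
  define B where "B s r = {\<beta> \<in> S. 0 < shooting m \<beta> s \<and> shooting m \<beta> s < shooting m \<beta> r}" for s r
  define AA where "AA = (\<Union>r\<in>{0..}. A r)"
  define BB where "BB = (\<Union>(s, r)\<in>{(s, r). 0 \<le> s \<and> s < r}. B s r)"
  have prof: "shooting_profile \<beta>" if "\<beta> \<in> S" for \<beta>
    using that by unfold_locales (auto simp: S_def)
  have v: "shooting_profile.v m \<beta> = shooting m \<beta>" if "\<beta> \<in> S" for \<beta>
    using shooting_profile.v_def[OF prof[OF that]] .
  have b0: "0 \<le> b" by (simp add: b_def)
  have cont: "continuous_on S (\<lambda>\<beta>. shooting m \<beta> r)" if "0 \<le> r" for r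
    using continuous_on_shooting_param[OF that] by (rule continuous_on_subset) (auto simp: S_def)
  \<comment> \<open>Both sets are unions, over fixed radii, of sets cut out by strict inequalities,
    so continuity in the parameter at each single radius makes them relatively open.\<close>
  have openA: "openin (top_of_set S) (A r)" if "0 \<le> r" for r
    using continuous_openin_preimage_gen[OF cont[OF that] open_lessThan[of 0]]
    by (auto simp: A_def vimage_def Int_def)
  have openB: "openin (top_of_set S) (B s r)" if "0 \<le> s" "s < r" for s r
  proof -
    have "openin (top_of_set S) (S \<inter> (\<lambda>\<beta>. shooting m \<beta> s) -` {0<..})"
      using that by (intro continuous_openin_preimage_gen cont) auto
    moreover have "openin (top_of_set S) (S \<inter> (\<lambda>\<beta>. shooting m \<beta> r - shooting m \<beta> s) -` {0<..})"
      using that by (intro continuous_openin_preimage_gen continuous_intros cont) auto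
    ultimately have "openin (top_of_set S) ((S \<inter> (\<lambda>\<beta>. shooting m \<beta> s) -` {0<..})
        \<inter> (S \<inter> (\<lambda>\<beta>. shooting m \<beta> r - shooting m \<beta> s) -` {0<..}))"
      by (rule openin_Int)
    also have "\<dots> = B s r" by (auto simp: B_def)
    finally show ?thesis .
  qed
  have "openin (top_of_set S) AA" "openin (top_of_set S) BB"
    unfolding AA_def BB_def using openA openB by (auto intro!: openin_Union)
  moreover have "AA \<inter> BB = {}"
  proof (rule ccontr)
    assume "AA \<inter> BB \<noteq> {}"
    then obtain \<beta> q s r where \<beta>: "\<beta> \<in> S" and "0 \<le> q" "shooting m \<beta> q < 0" "0 \<le> s" "s < r"
      "0 < shooting m \<beta> s" "shooting m \<beta> s < shooting m \<beta> r"
      by (auto simp: AA_def BB_def A_def B_def)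
    then show False
      using shooting_profile.not_neg_and_increasing[OF prof[OF \<beta>], of q m s r] by (simp add: v)
  qed
  moreover have "0 \<in> AA"
    using shooting_profile.profile_negative_zero[OF prof[of 0], of m] b0
    by (auto simp: AA_def A_def S_def v)
  moreover have "b \<in> BB"
    using shooting_profile.profile_increasing_large[OF prof[of b], of m] b0
    by (auto simp: BB_def B_def S_def v b_def)
  ultimately have "\<not> S \<subseteq> AA \<union> BB"
    using connected_Icc[of 0 b] unfolding connected_openin S_def[symmetric] by blast
  then obtain \<beta> where \<beta>: "\<beta> \<in> S" "\<beta> \<notin> AA" "\<beta> \<notin> BB" by blast
  have "critical_profile m \<beta>"
    unfolding critical_profile_def critical_profile_axioms_def v[OF \<beta>(1)]
  proof (intro conjI allI impI)
    show "0 \<le> shooting m \<beta> r" if "0 \<le> r" for r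
      using \<beta> that by (auto simp: AA_def A_def not_less)
    show "shooting m \<beta> r \<le> shooting m \<beta> s" if "0 \<le> s" "s < r" "0 < shooting m \<beta> s" for s r
      using \<beta> that unfolding BB_def B_def by (force simp: not_less)
  qed (rule prof[OF \<beta>(1)])
  then show ?thesis by blast
qed

lemma radial_solution_exists: "\<exists>u W. radial_solution m u W"
proof -
  obtain \<beta> where "critical_profile m \<beta>" using critical_profile_exists by blast
  then have "radial_solution m (critical_profile.u m \<beta>) (shooting_profile.W m \<beta>)"
    by (rule critical_profile.radial_solution_critical)
  then show ?thesis by blast
qed

section \<open>Behaviour of a solution at the origin\<close>

text \<open>Integration from the origin for functions controlled only on \<open>r > 0\<close>; the
  right limit serves as initial value.\<close>

lemma ge_limit_at_0_of_deriv_nonneg: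
  fixes f :: "real \<Rightarrow> real"
  assumes lim: "(f \<longlongrightarrow> l) (at_right 0)" and r: "0 < r"
    and der: "\<And>t. 0 < t \<Longrightarrow> t \<le> r \<Longrightarrow> (f has_real_derivative f' t) (at t)"
    and nonneg: "\<And>t. 0 < t \<Longrightarrow> t < r \<Longrightarrow> 0 \<le> f' t"
  shows "l \<le> f r"
proof (rule tendsto_upperbound[OF lim])
  have "f s \<le> f r" if s: "0 < s" "s < r" for s
  proof (rule DERIV_nonneg_imp_increasing_open[where f = f])
    show "\<exists>y. (f has_real_derivative y) (at x) \<and> 0 \<le> y" if "s < x" "x < r" for x
      using der[of x] nonneg[of x] that s by (intro exI[of _ "f' x"]) auto
    show "continuous_on {s..r} f"
      using s by (intro continuous_at_imp_continuous_on ballI DERIV_isCont[OF der]) auto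
  qed (use s in simp)
  then show "\<forall>\<^sub>F s in at_right 0. f s \<le> f r"
    using r unfolding eventually_at_right[OF r] by auto
qed simp

lemma gt_limit_at_0_of_deriv_pos:
  fixes f :: "real \<Rightarrow> real"
  assumes lim: "(f \<longlongrightarrow> l) (at_right 0)" and r: "0 < r"
    and der: "\<And>t. 0 < t \<Longrightarrow> (f has_real_derivative f' t) (at t)"
    and pos: "\<And>t. 0 < t \<Longrightarrow> 0 < f' t"
  shows "l < f r"
proof -
  have "l \<le> f (r / 2)"
    by (rule ge_limit_at_0_of_deriv_nonneg[OF lim, where f' = f']) (use r der pos in \<open>auto intro: less_imp_le\<close>)
  also have "f (r / 2) < f r"
  proof (rule DERIV_pos_imp_increasing[where f = f])
    show "\<exists>y. (f has_real_derivative y) (at x) \<and> 0 < y" if "r / 2 \<le> x" for x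
      using der[of x] pos[of x] that r by (intro exI[of _ "f' x"]) auto
  qed (use r in simp)
  finally show ?thesis .
qed

lemma abs_diff_limit_at_0_le:
  fixes f :: "real \<Rightarrow> real"
  assumes lim: "(f \<longlongrightarrow> l) (at_right 0)" and r: "0 < r"
    and der: "\<And>t. 0 < t \<Longrightarrow> t \<le> r \<Longrightarrow> (f has_real_derivative f' t) (at t)"
    and \<Phi>: "\<And>t. (\<Phi> has_real_derivative \<phi> t) (at t)"
    and le: "\<And>t. 0 < t \<Longrightarrow> t < r \<Longrightarrow> \<bar>f' t\<bar> \<le> \<phi> t"
  shows "\<bar>f r - l\<bar> \<le> \<Phi> r - \<Phi> 0"
proof -
  have \<Phi>0: "(\<Phi> \<longlongrightarrow> \<Phi> 0) (at_right 0)"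
    using DERIV_isCont[OF \<Phi>[of 0]] by (simp add: isCont_def filterlim_at_split)
  have "\<Phi> 0 - l \<le> \<Phi> r - f r"
    by (rule ge_limit_at_0_of_deriv_nonneg[where f = "\<lambda>t. \<Phi> t - f t" and f' = "\<lambda>t. \<phi> t - f' t"])
      (use r le in \<open>force intro!: tendsto_intros \<Phi>0 lim DERIV_diff \<Phi> der\<close>)+
  moreover have "\<Phi> 0 + l \<le> \<Phi> r + f r"
    by (rule ge_limit_at_0_of_deriv_nonneg[where f = "\<lambda>t. \<Phi> t + f t" and f' = "\<lambda>t. \<phi> t + f' t"])
      (use r le in \<open>force intro!: tendsto_intros \<Phi>0 lim DERIV_add \<Phi> der\<close>)+
  ultimately show ?thesis by linarith
qed

text \<open>If \<open>f' <= a / r\<close> with \<open>a < 0\<close>, then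
  \<open>f r - a * ln r\<close> is nonincreasing, so \<open>f\<close> exceeds every bound as
  \<open>r\<close> tends to 0.\<close>

lemma log_derivative_unbounded:
  fixes f :: "real \<Rightarrow> real"
  assumes "0 < r0" "a < 0"
    and der: "\<And>r. 0 < r \<Longrightarrow> r \<le> r0 \<Longrightarrow> (f has_real_derivative q r / r) (at r)"
    and q: "\<And>r. 0 < r \<Longrightarrow> r \<le> r0 \<Longrightarrow> q r \<le> a"
    and M: "\<And>r. 0 < r \<Longrightarrow> r \<le> r0 \<Longrightarrow> \<bar>f r\<bar> \<le> M"
  shows False
proof -
  \<comment> \<open>Moving from \<open>r0\<close> down to \<open>r0 * exp (- k)\<close> raises
    \<open>f\<close> by at least \<open>- a * k = 2 * M + 1\<close>, while \<open>|f| <= M\<close>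
    allows only \<open>2 * M\<close>.\<close>
  define k where "k = (2 * M + 1) / (- a)"
  have "0 \<le> M" using M[of r0] assms(1) by force
  then have k: "0 < k" unfolding k_def using assms(2) by (intro divide_pos_pos) auto
  define s where "s = r0 * exp (- k)"
  have s: "0 < s" "s \<le> r0" using assms(1) k by (auto simp: s_def)
  have "f r0 - a * ln r0 \<le> f s - a * ln s"
  proof (rule DERIV_nonpos_imp_nonincreasing[OF s(2), where f = "\<lambda>r. f r - a * ln r"])
    fix x assume x: "s \<le> x" "x \<le> r0"
    then have x0: "0 < x" using s by simp
    have "((\<lambda>r. f r - a * ln r) has_real_derivative q x / x - a * (1 / x)) (at x)"
      by (intro DERIV_diff DERIV_cmult DERIV_ln_divide der x0 x)
    moreover have "q x / x - a * (1 / x) \<le> 0"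
      using q[OF x0 x(2)] x0 by (simp add: divide_right_mono)
    ultimately show "\<exists>y. ((\<lambda>r. f r - a * ln r) has_real_derivative y) (at x) \<and> y \<le> 0" by blast
  qed
  moreover have "ln s = ln r0 - k"
    using assms(1) by (simp add: s_def ln_mult)
  moreover have "a * k = - (2 * M + 1)"
    unfolding k_def using assms(2) by simp
  then have "a * (ln r0 - k) = a * ln r0 + (2 * M + 1)"
    by (simp add: right_diff_distrib)
  ultimately have "f r0 \<le> f s - (2 * M + 1)" by simp
  then show False using M[of r0] M[of s] s assms(1) by (simp add: abs_le_iff)
qed

text \<open>A negative value of the monotone \<open>q\<close> persists towards 0, and so would a
  positive lower bound; either makes \<open>f\<close> logarithmically unbounded. Hence
  \<open>q\<close> is nonnegative, which makes \<open>f\<close> nondecreasing, and \<open>q\<close>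
  tends to 0.\<close>

lemma euler_derivative_monotone:
  fixes f :: "real \<Rightarrow> real"
  assumes e: "0 < e"
    and der: "\<And>r. 0 < r \<Longrightarrow> r \<le> e \<Longrightarrow> (f has_real_derivative q r / r) (at r)"
    and mono: "\<And>s t. 0 < s \<Longrightarrow> s \<le> t \<Longrightarrow> t \<le> e \<Longrightarrow> q s \<le> q t"
    and M: "\<And>r. 0 < r \<Longrightarrow> r \<le> e \<Longrightarrow> \<bar>f r\<bar> \<le> M"
  shows "(q \<longlongrightarrow> 0) (at_right 0)" and "\<And>s t. 0 < s \<Longrightarrow> s \<le> t \<Longrightarrow> t \<le> e \<Longrightarrow> f s \<le> f t"
proof -
  have nonneg: "0 \<le> q r" if r: "0 < r" "r \<le> e" for r
  proof (rule ccontr)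
    assume "\<not> 0 \<le> q r"
    then show False
      using log_derivative_unbounded[of r "q r" f q M] der mono M r by force
  qed
  show "f s \<le> f t" if st: "0 < s" "s \<le> t" "t \<le> e" for s t
  proof (rule DERIV_nonneg_imp_nondecreasing[OF st(2), where f = f])
    fix x assume "s \<le> x" "x \<le> t"
    then show "\<exists>y. (f has_real_derivative y) (at x) \<and> 0 \<le> y"
      using der[of x] nonneg[of x] st by (intro exI[of _ "q x / x"]) auto
  qed
  have small: "\<exists>r. 0 < r \<and> r \<le> e \<and> q r < a" if a: "0 < a" for a
  proof (rule ccontr)
    assume *: "\<not> ?thesis"
    show False
    proof (rule log_derivative_unbounded[of e "- a" "\<lambda>r. - f r" "\<lambda>r. - q r" M])
      show "((\<lambda>r. - f r) has_real_derivative - q r / r) (at r)" if "0 < r" "r \<le> e" for r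
        using DERIV_minus[OF der[OF that]] by simp
    qed (use * a e M in \<open>auto simp: not_less\<close>)
  qed
  show "(q \<longlongrightarrow> 0) (at_right 0)"
  proof (rule tendstoI)
    fix a :: real assume "0 < a"
    then obtain r where r: "0 < r" "r \<le> e" "q r < a" using small by blast
    have "dist (q s) 0 < a" if "0 < s" "s < r" for s
      using nonneg[of s] mono[of s r] r that by simp
    then show "\<forall>\<^sub>F s in at_right 0. dist (q s) 0 < a"
      unfolding eventually_at_right[OF r(1)] using r(1) by blast
  qed
qed

text \<open>Rescaled form of \<open>ln x <= x - 1\<close>; it turns bounds on the log-ratio
  \<open>p\<close> into bounds on \<open>u2 - u1\<close>.\<close>

lemma abs_diff_le_ln:
  fixes a b U :: real
  assumes "0 < a" "0 < b" "a \<le> U" "b \<le> U"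
  shows "\<bar>b - a\<bar> \<le> U * \<bar>ln b - ln a\<bar>"
proof -
  have *: "y - x \<le> U * (ln y - ln x)" if "0 < x" "x \<le> y" "y \<le> U" for x y :: real
  proof -
    have "ln (x / y) \<le> x / y - 1" using that by (intro ln_le_minus_one) auto
    then have "(y - x) / y \<le> ln y - ln x" using that by (simp add: ln_div diff_divide_distrib)
    then have "y - x \<le> y * (ln y - ln x)" using that by (simp add: pos_divide_le_eq mult.commute)
    also have "\<dots> \<le> U * (ln y - ln x)" using that by (intro mult_right_mono) auto
    finally show ?thesis .
  qed
  show ?thesis
    using *[of a b] *[of b a] assms by (cases "a \<le> b") (auto simp: abs_if)
qed

locale radial_sol =
  fixes m :: nat and u W :: "real \<Rightarrow> real"
  assumes sol: "radial_solution m u W"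
begin

definition q :: "real \<Rightarrow> real" where "q r = r * deriv u r"

lemma cont_u: "continuous_on {0..} u" and cont_W: "continuous_on {0..} W" and W_0: "W 0 = 0"
  and u_pos: "0 < r \<Longrightarrow> 0 < u r" and u_lim: "(u \<longlongrightarrow> 0) at_top"
  and dW_lim: "(deriv W \<longlongrightarrow> 0) (at_right 0)"
  using sol unfolding radial_solution_def by blast+

lemma DERIV_u: "0 < r \<Longrightarrow> (u has_real_derivative q r / r) (at r)"
  using sol unfolding radial_solution_def q_def by (auto simp: DERIV_deriv_iff_real_differentiable)

lemma DERIV_W: "0 < r \<Longrightarrow> (W has_real_derivative deriv W r) (at r)"
  using sol unfolding radial_solution_def by (auto simp: DERIV_deriv_iff_real_differentiable)

lemma DERIV_q:
  assumes r: "0 < r"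
  shows "(q has_real_derivative ((real m)\<^sup>2 + r\<^sup>2 * (W r - 1)) * u r / r) (at r)"
proof -
  have "(deriv u has_real_derivative deriv (deriv u) r) (at r)"
    using sol r unfolding radial_solution_def by (auto simp: DERIV_deriv_iff_real_differentiable)
  then have "(q has_real_derivative r * deriv (deriv u) r + 1 * deriv u r) (at r)"
    unfolding q_def by (intro DERIV_mult' DERIV_ident)
  moreover have "r * deriv (deriv u) r + 1 * deriv u r = ((real m)\<^sup>2 + r\<^sup>2 * (W r - 1)) * u r / r"
  proof -
    have eq: "deriv (deriv u) r = (W r - 1) * u r + (real m)\<^sup>2 / r\<^sup>2 * u r - deriv u r / r"
      using sol r unfolding radial_solution_def by (auto simp: algebra_simps)
    show ?thesis unfolding eq using r by (simp add: field_simps power2_eq_square)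
  qed
  ultimately show ?thesis by simp
qed

lemma DERIV_r_dW:
  assumes r: "0 < r"
  shows "((\<lambda>r. r * deriv W r) has_real_derivative r * (u r)\<^sup>2) (at r)"
proof -
  have "(deriv W has_real_derivative deriv (deriv W) r) (at r)"
    using sol r unfolding radial_solution_def by (auto simp: DERIV_deriv_iff_real_differentiable)
  then have "((\<lambda>r. r * deriv W r) has_real_derivative r * deriv (deriv W) r + 1 * deriv W r) (at r)"
    by (intro DERIV_mult' DERIV_ident)
  moreover have "r * deriv (deriv W) r + 1 * deriv W r = r * (u r)\<^sup>2"
  proof -
    have eq: "deriv (deriv W) r = (u r)\<^sup>2 - deriv W r / r"
      using sol r unfolding radial_solution_def by (auto simp: algebra_simps)
    show ?thesis unfolding eq using r by (simp add: field_simps)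
  qed
  ultimately show ?thesis by simp
qed

lemma u_bounded:
  obtains M where "0 < M" "\<And>r. 0 \<le> r \<Longrightarrow> r \<le> R \<Longrightarrow> \<bar>u r\<bar> \<le> M"
proof -
  have "compact (u ` {0..R})"
    by (intro compact_continuous_image continuous_on_subset[OF cont_u]) auto
  then have "bounded (u ` {0..R})" by (rule compact_imp_bounded)
  then obtain M where "0 < M" "\<And>x. x \<in> u ` {0..R} \<Longrightarrow> norm x \<le> M"
    unfolding bounded_pos by auto
  then show thesis using that[of M] by auto
qed

text \<open>
  In the variable \<open>ln r\<close> the equation is \<open>u'' = (m\<^sup>2 + r\<^sup>2 * (W - 1)) * u\<close>: near the origin \<open>u\<close> is convex if
  \<open>m > 0\<close> and concave if \<open>m = 0\<close>, and it is bounded, so its derivative \<open>q\<close> tends to \<open>0\<close>.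
\<close>

lemma near_0:
  obtains e where "0 < e" "(q \<longlongrightarrow> 0) (at_right 0)"
    "\<And>s t. 0 < s \<Longrightarrow> s \<le> t \<Longrightarrow> t \<le> e \<Longrightarrow> u s \<le> u t \<or> u e \<le> u t"
proof -
  have "(W \<longlongrightarrow> W 0) (at 0 within {0..})"
    using cont_W unfolding continuous_on_def by blast
  then have "\<forall>\<^sub>F r in at 0 within {0..}. dist (W r) (W 0) < 1"
    by (rule tendstoD) simp
  then obtain d where d: "0 < d" "\<And>r. 0 < r \<Longrightarrow> r < d \<Longrightarrow> \<bar>W r\<bar> < 1"
    unfolding eventually_at by (auto simp: dist_real_def W_0)
  \<comment> \<open>For \<open>r <= 1 / 2\<close> and \<open>|W| < 1\<close> one has
    \<open>r^2 * (1 - W) <= 1 / 2\<close>, which is below \<open>m^2\<close> as soon as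
    \<open>m > 0\<close>, so the coefficient of \<open>u\<close> has a sign.\<close>
  define e where "e = min (d / 2) (1 / 2)"
  have e: "0 < e" "e < d" "e \<le> 1 / 2" using d by (auto simp: e_def)
  obtain M where "0 < M" and M: "\<And>r. 0 \<le> r \<Longrightarrow> r \<le> e \<Longrightarrow> \<bar>u r\<bar> \<le> M"
    by (rule u_bounded[of e]) blast
  have W: "\<bar>W r\<bar> < 1" if "0 < r" "r \<le> e" for r using d(2)[of r] that e by simp
  \<comment> \<open>The two alternatives of the conclusion are the two cases: \<open>u\<close> is
    nondecreasing near 0 if \<open>m > 0\<close>, and nonincreasing, hence at least
    \<open>u e\<close>, if \<open>m = 0\<close>.\<close>
  show thesis
  proof (cases "m = 0")
    case False
    have mono: "q s \<le> q t" if st: "0 < s" "s \<le> t" "t \<le> e" for s t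
    proof (rule DERIV_nonneg_imp_nondecreasing[OF st(2), where f = q])
      fix x assume x: "s \<le> x" "x \<le> t"
      have "x\<^sup>2 \<le> (1 / 2)\<^sup>2" using x st e by (intro power_mono) auto
      moreover have "x\<^sup>2 * (1 - W x) \<le> x\<^sup>2 * 2"
        using W[of x] x st by (intro mult_left_mono) auto
      moreover have "1 \<le> (real m)\<^sup>2" using False by simp
      ultimately have "0 \<le> (real m)\<^sup>2 + x\<^sup>2 * (W x - 1)"
        by (simp add: power2_eq_square algebra_simps)
      then show "\<exists>y. (q has_real_derivative y) (at x) \<and> 0 \<le> y"
        using DERIV_q[of x] u_pos[of x] x st
        by (intro exI[of _ "((real m)\<^sup>2 + x\<^sup>2 * (W x - 1)) * u x / x"]) auto
    qed
    have "(q \<longlongrightarrow> 0) (at_right 0)"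
      by (rule euler_derivative_monotone[OF e(1) DERIV_u mono M]) auto
    moreover have "u s \<le> u t" if "0 < s" "s \<le> t" "t \<le> e" for s t
      by (rule euler_derivative_monotone(2)[OF e(1) DERIV_u mono M]) (use that in auto)
    ultimately show thesis using that e by blast
  next
    case True
    have mono: "- q s \<le> - q t" if st: "0 < s" "s \<le> t" "t \<le> e" for s t
    proof (rule DERIV_nonneg_imp_nondecreasing[OF st(2), where f = "\<lambda>x. - q x"])
      fix x assume x: "s \<le> x" "x \<le> t"
      then have x0: "0 < x" using st by simp
      have "x\<^sup>2 * (W x - 1) \<le> 0"
        using W[of x] x st by (intro mult_nonneg_nonpos) auto
      then have "((real m)\<^sup>2 + x\<^sup>2 * (W x - 1)) * u x / x \<le> 0"
        using u_pos[OF x0] x0 True by (intro divide_nonpos_pos mult_nonpos_nonneg) auto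
      then show "\<exists>y. ((\<lambda>x. - q x) has_real_derivative y) (at x) \<and> 0 \<le> y"
        using DERIV_minus[OF DERIV_q[OF x0]]
        by (intro exI[of _ "- (((real m)\<^sup>2 + x\<^sup>2 * (W x - 1)) * u x / x)"]) auto
    qed
    have der: "((\<lambda>r. - u r) has_real_derivative - q r / r) (at r)" if "0 < r" for r
      using DERIV_minus[OF DERIV_u[OF that]] by simp
    have M': "\<bar>- u r\<bar> \<le> M" if "0 < r" "r \<le> e" for r using M[of r] that by simp
    have "((\<lambda>r. - q r) \<longlongrightarrow> 0) (at_right 0)"
      by (rule euler_derivative_monotone[OF e(1) der mono M']) auto
    from tendsto_minus[OF this] have "(q \<longlongrightarrow> 0) (at_right 0)" by simp
    moreover have "u e \<le> u t" if "0 < t" "t \<le> e" for t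
      using euler_derivative_monotone(2)[OF e(1) der mono M', of t e] that by auto
    ultimately show thesis using that e by force
  qed
qed

lemma q_lim: "(q \<longlongrightarrow> 0) (at_right 0)"
  by (rule near_0)

text \<open>A one-sided Harnack inequality, replacing a positive lower bound that fails if
  \<open>u\<close> vanishes at the origin. Near 0 it comes from the alternative of
  \<open>near_0\<close>, farther out from the positive minimum \<open>k\<close> on a compact
  interval. In the constant, 1 covers \<open>u s <= u t\<close> and \<open>M / k\<close> covers
  \<open>k <= u t\<close>.\<close>

lemma u_le_mult_later:
  obtains C where "0 < C" "\<And>s t. 0 < s \<Longrightarrow> s \<le> t \<Longrightarrow> t \<le> R \<Longrightarrow> u s \<le> C * u t"
proof -
  obtain e where e: "0 < e" "(q \<longlongrightarrow> 0) (at_right 0)"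
    and alt: "\<And>s t. 0 < s \<Longrightarrow> s \<le> t \<Longrightarrow> t \<le> e \<Longrightarrow> u s \<le> u t \<or> u e \<le> u t"
    by (rule near_0) blast
  define R' where "R' = max R e"
  obtain M where M: "0 < M" "\<And>r. 0 \<le> r \<Longrightarrow> r \<le> R' \<Longrightarrow> \<bar>u r\<bar> \<le> M"
    by (rule u_bounded[of R']) blast
  have "\<exists>x\<in>{e..R'}. \<forall>y\<in>{e..R'}. u x \<le> u y"
    by (rule continuous_attains_inf) (use e in \<open>auto simp: R'_def intro: continuous_on_subset[OF cont_u]\<close>)
  then obtain x where x: "x \<in> {e..R'}" "\<And>y. y \<in> {e..R'} \<Longrightarrow> u x \<le> u y" by blast
  define k where "k = u x"
  have k: "0 < k" using x e u_pos[of x] by (simp add: k_def)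
  have "u s \<le> (1 + M / k) * u t" if st: "0 < s" "s \<le> t" "t \<le> R" for s t
  proof -
    have ut: "0 < u t" using u_pos st by simp
    have "s \<le> R'" using st by (simp add: R'_def le_max_iff_disj)
    then have us: "u s \<le> M" using M(2)[of s] st by simp
    have "u s \<le> u t \<or> k \<le> u t"
      using alt[of s t] x(2)[of t] x(2)[of e] st e by (cases "t \<le> e") (auto simp: k_def R'_def)
    then show ?thesis
    proof
      assume "k \<le> u t"
      then have "M / k * k \<le> M / k * u t" using M k by (intro mult_left_mono) auto
      then show ?thesis using us ut k by (simp add: distrib_right)
    next
      assume "u s \<le> u t"
      moreover have "0 \<le> M / k * u t" using M k ut by simp
      ultimately show ?thesis by (simp add: distrib_right)
    qed
  qed
  moreover have "0 < 1 + M / k" using M k by (simp add: add_pos_pos)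
  ultimately show thesis using that by blast
qed

end

section \<open>Uniqueness\<close>

locale two_solutions =
  fixes m :: nat and u1 W1 u2 W2 :: "real \<Rightarrow> real"
  assumes sol1: "radial_solution m u1 W1" and sol2: "radial_solution m u2 W2"

sublocale two_solutions \<subseteq> S1: radial_sol m u1 W1
  by unfold_locales (rule sol1)

sublocale two_solutions \<subseteq> S2: radial_sol m u2 W2
  by unfold_locales (rule sol2)

context two_solutions
begin

definition p :: "real \<Rightarrow> real" where "p r = ln (u2 r) - ln (u1 r)"
definition D :: "real \<Rightarrow> real" where "D r = W2 r - W1 r"
definition w :: "real \<Rightarrow> real" where "w r = u1 r * S2.q r - u2 r * S1.q r"
definition g :: "real \<Rightarrow> real" where "g r = r * deriv W2 r - r * deriv W1 r"

text \<open>Both equations have the same terms in \<open>m^2\<close> and \<open>- r^2\<close>; they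
  cancel in the Wronskian and only the difference of the potentials survives.\<close>

lemma DERIV_w:
  assumes r: "0 < r"
  shows "(w has_real_derivative r * u1 r * u2 r * D r) (at r)"
proof -
  let ?Q = "\<lambda>W u. ((real m)\<^sup>2 + r\<^sup>2 * (W - 1)) * u / r"
  have "(w has_real_derivative (u1 r * ?Q (W2 r) (u2 r) + S1.q r / r * S2.q r)
      - (u2 r * ?Q (W1 r) (u1 r) + S2.q r / r * S1.q r)) (at r)"
    unfolding w_def by (intro DERIV_diff DERIV_mult' S1.DERIV_u S2.DERIV_u S1.DERIV_q S2.DERIV_q r)
  moreover have "(u1 r * ?Q (W2 r) (u2 r) + S1.q r / r * S2.q r)
      - (u2 r * ?Q (W1 r) (u1 r) + S2.q r / r * S1.q r) = r * u1 r * u2 r * D r"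
    using r by (simp add: D_def field_simps power2_eq_square)
  ultimately show ?thesis by simp
qed

lemma w_lim: "(w \<longlongrightarrow> 0) (at_right 0)"
proof -
  have "(u1 \<longlongrightarrow> u1 0) (at 0 within {0..})" "(u2 \<longlongrightarrow> u2 0) (at 0 within {0..})"
    using S1.cont_u S2.cont_u unfolding continuous_on_def by blast+
  then have "(u1 \<longlongrightarrow> u1 0) (at_right 0)" "(u2 \<longlongrightarrow> u2 0) (at_right 0)"
    by (auto elim!: tendsto_within_subset)
  then have "(w \<longlongrightarrow> u1 0 * 0 - u2 0 * 0) (at_right 0)"
    unfolding w_def by (intro tendsto_intros S1.q_lim S2.q_lim)
  then show ?thesis by simp
qed

lemma DERIV_p:
  assumes r: "0 < r"
  shows "(p has_real_derivative w r / (r * (u1 r * u2 r))) (at r)"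
proof -
  have u: "0 < u1 r" "0 < u2 r" using S1.u_pos S2.u_pos r by auto
  have "(p has_real_derivative (S2.q r / r) / u2 r - (S1.q r / r) / u1 r) (at r)"
    unfolding p_def
    by (intro DERIV_diff) (use u r in \<open>auto intro!: derivative_eq_intros S1.DERIV_u S2.DERIV_u\<close>)
  moreover have "(S2.q r / r) / u2 r - (S1.q r / r) / u1 r = w r / (r * (u1 r * u2 r))"
    using u r by (simp add: w_def field_simps)
  ultimately show ?thesis by simp
qed

lemma DERIV_D: "0 < r \<Longrightarrow> (D has_real_derivative g r / r) (at r)"
  unfolding D_def g_def using DERIV_diff[OF S2.DERIV_W S1.DERIV_W, of r]
  by (simp add: diff_divide_distrib)

lemma cont_D: "continuous_on {0..} D"
  unfolding D_def by (intro continuous_intros S1.cont_W S2.cont_W)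

lemma D_lim: "(D \<longlongrightarrow> 0) (at_right 0)"
proof -
  have "(D \<longlongrightarrow> D 0) (at 0 within {0..})"
    using cont_D unfolding continuous_on_def by blast
  then have "(D \<longlongrightarrow> D 0) (at_right 0)" by (rule tendsto_within_subset) auto
  then show ?thesis by (simp add: D_def S1.W_0 S2.W_0)
qed

lemma DERIV_g: "0 < r \<Longrightarrow> (g has_real_derivative r * ((u2 r)\<^sup>2 - (u1 r)\<^sup>2)) (at r)"
  unfolding g_def using DERIV_diff[OF S2.DERIV_r_dW S1.DERIV_r_dW, of r]
  by (simp add: right_diff_distrib)

lemma g_lim: "(g \<longlongrightarrow> 0) (at_right 0)"
proof -
  have "(g \<longlongrightarrow> 0 * 0 - 0 * 0) (at_right 0)"
    unfolding g_def by (intro tendsto_intros S1.dW_lim S2.dW_lim)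
  then show ?thesis by simp
qed

section \<open>The limit of the log-ratio at the origin\<close>

lemma abs_DERIV_p_le:
  assumes t: "0 < t" "t \<le> R"
    and C: "\<And>s t. 0 < s \<Longrightarrow> s \<le> t \<Longrightarrow> t \<le> R \<Longrightarrow> u1 s * u2 s \<le> C * (u1 t * u2 t)"
    and K: "\<And>s. 0 < s \<Longrightarrow> s \<le> t \<Longrightarrow> \<bar>D s\<bar> \<le> K"
  shows "\<bar>w t / (t * (u1 t * u2 t))\<bar> \<le> C * K * t"
proof -
  have K0: "0 \<le> K" using K[of t] t by force
  have ut: "0 < u1 t * u2 t" using S1.u_pos S2.u_pos t by simp
  \<comment> \<open>\<open>w t\<close> is the integral of \<open>s * u1 s * u2 s * D s\<close> from
    0. Bounding \<open>u1 s * u2 s\<close> by its value at \<open>t\<close> produces the very factor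
    that the denominator cancels.\<close>
  define A where "A = C * (u1 t * u2 t) * K"
  have "\<bar>w t - 0\<bar> \<le> A * t\<^sup>2 / 2 - A * 0\<^sup>2 / 2"
  proof (rule abs_diff_limit_at_0_le[OF w_lim t(1) DERIV_w])
    show "((\<lambda>t. A * t\<^sup>2 / 2) has_real_derivative A * s) (at s)" for s
      by (auto intro!: derivative_eq_intros)
    fix s assume s: "0 < s" "s < t"
    have us: "0 < u1 s * u2 s" using S1.u_pos S2.u_pos s by simp
    have "\<bar>s * u1 s * u2 s * D s\<bar> = s * ((u1 s * u2 s) * \<bar>D s\<bar>)"
      using s us by (simp add: abs_mult abs_of_pos S1.u_pos S2.u_pos)
    also have "\<dots> \<le> s * (C * (u1 t * u2 t) * K)"
    proof (rule mult_left_mono)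
      have "0 \<le> C * (u1 t * u2 t)" using C[of s t] us s t by linarith
      then show "(u1 s * u2 s) * \<bar>D s\<bar> \<le> C * (u1 t * u2 t) * K"
        using C[of s t] K[of s] s t by (intro mult_mono[of "u1 s * u2 s"]) auto
    qed (use s in simp)
    finally show "\<bar>s * u1 s * u2 s * D s\<bar> \<le> A * s" by (simp add: A_def mult.commute)
  qed
  then have "\<bar>w t\<bar> \<le> A * t\<^sup>2 / 2" by simp
  also have "\<dots> \<le> A * t\<^sup>2"
  proof -
    have "0 < C * (u1 t * u2 t)" using C[of t t] t ut by linarith
    then have "0 \<le> A" unfolding A_def using K0 by simp
    then show ?thesis by simp
  qed
  also have "\<dots> = (C * K * t) * (t * (u1 t * u2 t))" by (simp add: A_def power2_eq_square)
  finally have "\<bar>w t\<bar> \<le> (C * K * t) * (t * (u1 t * u2 t))" .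
  moreover have "0 < t * (u1 t * u2 t)" using t ut by simp
  ultimately show ?thesis by (simp only: abs_divide abs_of_pos pos_divide_le_eq)
qed

lemma prod_le_mult_later:
  obtains C where "0 < C" "\<And>s t. 0 < s \<Longrightarrow> s \<le> t \<Longrightarrow> t \<le> R \<Longrightarrow> u1 s * u2 s \<le> C * (u1 t * u2 t)"
proof -
  obtain C1 where C1: "0 < C1" "\<And>s t. 0 < s \<Longrightarrow> s \<le> t \<Longrightarrow> t \<le> R \<Longrightarrow> u1 s \<le> C1 * u1 t"
    by (rule S1.u_le_mult_later[of R]) blast
  obtain C2 where C2: "0 < C2" "\<And>s t. 0 < s \<Longrightarrow> s \<le> t \<Longrightarrow> t \<le> R \<Longrightarrow> u2 s \<le> C2 * u2 t"
    by (rule S2.u_le_mult_later[of R]) blast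
  have "u1 s * u2 s \<le> (C1 * C2) * (u1 t * u2 t)" if st: "0 < s" "s \<le> t" "t \<le> R" for s t
  proof -
    have "u1 s * u2 s \<le> (C1 * u1 t) * (C2 * u2 t)"
    proof (rule mult_mono)
      show "u1 s \<le> C1 * u1 t" "u2 s \<le> C2 * u2 t" using C1(2) C2(2) st by auto
      show "0 \<le> C1 * u1 t" "0 \<le> u2 s"
        using C1(1) S1.u_pos[of t] S2.u_pos[of s] st by auto
    qed
    then show ?thesis by (simp add: mult_ac)
  qed
  then show thesis using that[of "C1 * C2"] C1(1) C2(1) by simp
qed

text \<open>The bounded derivative makes \<open>p\<close> Lipschitz on the open unit interval, hence
  continuously extendable to 0.\<close>

lemma p_has_limit: "\<exists>l. (p \<longlongrightarrow> l) (at_right 0)"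
proof -
  obtain C where C: "0 < C" "\<And>s t. 0 < s \<Longrightarrow> s \<le> t \<Longrightarrow> t \<le> 1 \<Longrightarrow> u1 s * u2 s \<le> C * (u1 t * u2 t)"
    by (rule prod_le_mult_later[of 1]) blast
  have "compact (D ` {0..1})"
    by (intro compact_continuous_image continuous_on_subset[OF cont_D]) auto
  then have "bounded (D ` {0..1})" by (rule compact_imp_bounded)
  then obtain K where K: "0 < K" "\<And>x. x \<in> D ` {0..1} \<Longrightarrow> norm x \<le> K"
    unfolding bounded_pos by auto
  have der: "\<bar>w t / (t * (u1 t * u2 t))\<bar> \<le> C * K" if t: "0 < t" "t < 1" for t
  proof -
    have "\<bar>w t / (t * (u1 t * u2 t))\<bar> \<le> C * K * t"
    proof (rule abs_DERIV_p_le[of t 1])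
      show "\<bar>D s\<bar> \<le> K" if "0 < s" "s \<le> t" for s
        using K(2)[of "D s"] that t by simp
    qed (use t in simp_all, rule C(2))
    also have "\<dots> \<le> C * K * 1" using t C(1) K(1) by (intro mult_left_mono) auto
    finally show ?thesis by simp
  qed
  have "(C * K)-lipschitz_on {0<..<1} p"
  proof (rule lipschitz_onI)
    fix x y :: real assume xy: "x \<in> {0<..<1}" "y \<in> {0<..<1}"
    have "norm (p x - p y) \<le> C * K * norm (x - y)"
    proof (rule field_differentiable_bound[of "{0<..<1}" p "\<lambda>t. w t / (t * (u1 t * u2 t))"])
      show "(p has_field_derivative w z / (z * (u1 z * u2 z))) (at z within {0<..<1})"
        if "z \<in> {0<..<1}" for z
        using that by (simp add: has_field_derivative_at_within[OF DERIV_p])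
      show "norm (w z / (z * (u1 z * u2 z))) \<le> C * K" if "z \<in> {0<..<1}" for z
        using der[of z] that by simp
    qed (fact xy | simp)+
    then show "dist (p x) (p y) \<le> C * K * dist x y" by (simp add: dist_norm)
  qed (use C(1) K(1) in simp)
  then have "uniformly_continuous_on {0<..<1} p" by (rule lipschitz_on_uniformly_continuous)
  moreover have "0 \<in> closure {0<..<1::real}" by (simp add: closure_greaterThanLessThan)
  ultimately obtain l where "(p \<longlongrightarrow> l) (at 0 within {0<..<1})"
    by (rule uniformly_continuous_on_extension_at_closure)
  moreover have "at 0 within {0<..<1} = at_right (0::real)"
    by (rule at_within_nhd[where S = "{..<1}"]) auto
  ultimately show ?thesis by auto
qed

section \<open>Excluding a positive limit\<close>

lemma limit_pos_imp_ratio_pos: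
  assumes lim: "(p \<longlongrightarrow> l) (at_right 0)" and l: "0 < l" and r: "0 < r"
  shows "0 < p r"
proof (rule ccontr)
  assume neg: "\<not> 0 < p r"
  have "\<forall>\<^sub>F s in at_right 0. 0 < p s" using order_tendstoD(1)[OF lim l] .
  then obtain d where d: "0 < d" "\<And>s. 0 < s \<Longrightarrow> s < d \<Longrightarrow> 0 < p s"
    unfolding eventually_at_right[OF zero_less_one] by blast
  \<comment> \<open>Bootstrap up to the first zero \<open>e\<close> of \<open>p\<close>: before
    \<open>e\<close> one has \<open>u2 > u1\<close>, so \<open>g\<close>, \<open>D\<close> and
    \<open>w\<close> are nonnegative in turn and \<open>p\<close> is nondecreasing; then
    \<open>p e >= l > 0\<close>.\<close>
  define a where "a = min (d / 2) (r / 2)"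
  have a: "0 < a" "a < d" "a \<le> r" using d r by (auto simp: a_def)
  have "continuous_on {a..r} (\<lambda>x. - p x)"
    using a by (intro continuous_intros continuous_at_imp_continuous_on ballI DERIV_isCont[OF DERIV_p]) auto
  then obtain e where e: "a < e" "e \<le> r" "- p e = 0" "\<And>x. a \<le> x \<Longrightarrow> x < e \<Longrightarrow> - p x < 0"
    using first_zero[of a r "\<lambda>x. - p x"] a d(2)[of a] neg by auto
  have e0: "0 < e" using a e by simp
  have pos: "0 < p x" if "0 < x" "x < e" for x
    using d(2)[of x] e(4)[of x] that a by (cases "x < a") auto
  have g: "0 \<le> g x" if x: "0 < x" "x \<le> e" for x
  proof (rule ge_limit_at_0_of_deriv_nonneg[OF g_lim x(1) DERIV_g])
    fix t assume "0 < t" "t < x"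
    then show "0 \<le> t * ((u2 t)\<^sup>2 - (u1 t)\<^sup>2)"
      using pos[of t] S1.u_pos[of t] S2.u_pos[of t] x by (auto simp: p_def power_mono)
  qed
  have D: "0 \<le> D x" if x: "0 < x" "x \<le> e" for x
    by (rule ge_limit_at_0_of_deriv_nonneg[OF D_lim x(1) DERIV_D]) (use x g in auto)
  have w: "0 \<le> w x" if x: "0 < x" "x \<le> e" for x
  proof (rule ge_limit_at_0_of_deriv_nonneg[OF w_lim x(1) DERIV_w])
    fix t assume "0 < t" "t < x"
    then show "0 \<le> t * u1 t * u2 t * D t"
      using D[of t] S1.u_pos[of t] S2.u_pos[of t] x by simp
  qed
  have "l \<le> p e"
  proof (rule ge_limit_at_0_of_deriv_nonneg[OF lim e0 DERIV_p])
    fix t assume "0 < t" "t < e"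
    then show "0 \<le> w t / (t * (u1 t * u2 t))"
      using w[of t] S1.u_pos[of t] S2.u_pos[of t] by simp
  qed
  then show False using e(3) l by simp
qed

lemma limit_not_pos:
  assumes lim: "(p \<longlongrightarrow> l) (at_right 0)" and l: "0 < l"
  shows False
proof -
  have lt: "u1 r < u2 r" if "0 < r" for r
    using limit_pos_imp_ratio_pos[OF lim l that] S1.u_pos[OF that] S2.u_pos[OF that] by (simp add: p_def)
  have g: "0 < g r" if r: "0 < r" for r
  proof (rule gt_limit_at_0_of_deriv_pos[OF g_lim r DERIV_g])
    fix t :: real assume t: "0 < t"
    then show "0 < t * ((u2 t)\<^sup>2 - (u1 t)\<^sup>2)"
      using lt[OF t] S1.u_pos[OF t] by (simp add: power_strict_mono)
  qed
  have D: "0 < D r" if r: "0 < r" for r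
    by (rule gt_limit_at_0_of_deriv_pos[OF D_lim r DERIV_D]) (use g in auto)
  have w': "0 < r * u1 r * u2 r * D r" if r: "0 < r" for r
    using r D[OF r] S1.u_pos[OF r] S2.u_pos[OF r] by simp
  define c where "c = w 1"
  have c: "0 < c"
    unfolding c_def by (rule gt_limit_at_0_of_deriv_pos[OF w_lim zero_less_one DERIV_w w'])
  have w: "c \<le> w r" if "1 \<le> r" for r
    unfolding c_def
  proof (rule DERIV_nonneg_imp_nondecreasing[OF that, where f = w])
    fix x :: real assume x: "1 \<le> x"
    then show "\<exists>y. (w has_real_derivative y) (at x) \<and> 0 \<le> y"
      using DERIV_w[of x] w'[of x] by (intro exI[of _ "x * u1 x * u2 x * D x"]) auto
  qed
  \<comment> \<open>The decay at infinity enters here: with \<open>u2 < 1\<close> the ratio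
    \<open>h = u1 / u2\<close> has derivative at most \<open>- c / r\<close>.\<close>
  have "\<forall>\<^sub>F r in at_top. u2 r < 1" using order_tendstoD(2)[OF S2.u_lim zero_less_one] .
  then obtain R0 where R0: "\<And>r. R0 \<le> r \<Longrightarrow> u2 r < 1"
    unfolding eventually_at_top_linorder by blast
  define R where "R = max 1 R0"
  define h where "h r = u1 r / u2 r" for r
  \<comment> \<open>Between \<open>R\<close> and \<open>R * exp k\<close> the ratio loses at least
    \<open>c * k = h R\<close>, its whole value at \<open>R\<close>.\<close>
  define k where "k = h R / c"
  have R: "1 \<le> R" "R0 \<le> R" by (auto simp: R_def)
  have "0 < h R" using R S1.u_pos[of R] S2.u_pos[of R] by (simp add: h_def)
  then have k: "0 < k" using c by (simp add: k_def)
  define r where "r = R * exp k"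
  have r: "R \<le> r" using R k by (simp add: r_def)
  have "h r + c * ln r \<le> h R + c * ln R"
  proof (rule DERIV_nonpos_imp_nonincreasing[OF r, where f = "\<lambda>x. h x + c * ln x"])
    fix x assume x: "R \<le> x"
    then have x0: "0 < x" using R by simp
    have u: "0 < u1 x" "0 < u2 x" "u2 x < 1" using S1.u_pos S2.u_pos R0[of x] x x0 R by auto
    have "(h has_real_derivative (S1.q x / x * u2 x - u1 x * (S2.q x / x)) / (u2 x * u2 x)) (at x)"
      unfolding h_def by (intro DERIV_divide S1.DERIV_u S2.DERIV_u x0) (use u in auto)
    moreover have "(S1.q x / x * u2 x - u1 x * (S2.q x / x)) / (u2 x * u2 x) = - (w x / (x * (u2 x * u2 x)))"
      using x0 u by (simp add: w_def field_simps)
    ultimately have "((\<lambda>x. h x + c * ln x) has_real_derivative - (w x / (x * (u2 x * u2 x))) + c * (1 / x)) (at x)"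
      using x0 by (intro DERIV_add DERIV_cmult DERIV_ln_divide) auto
    moreover have "c * (1 / x) \<le> w x / (x * (u2 x * u2 x))"
    proof -
      have "u2 x * u2 x \<le> 1" using u by (simp add: mult_le_one)
      then have "c * (x * (u2 x * u2 x)) \<le> w x * x"
        using w[of x] x R c x0 u mult_mono[of c "w x" "x * (u2 x * u2 x)" x] by simp
      then show ?thesis using x0 u by (simp add: field_simps)
    qed
    ultimately show "\<exists>y. ((\<lambda>x. h x + c * ln x) has_real_derivative y) (at x) \<and> y \<le> 0" by force
  qed
  moreover have "ln r = ln R + k" using R by (simp add: r_def ln_mult)
  moreover have "c * (ln R + k) = c * ln R + h R" using c by (simp add: k_def distrib_left)
  ultimately have "h r \<le> 0" by simp
  moreover have "0 < h r" using R r S1.u_pos[of r] S2.u_pos[of r] by (simp add: h_def)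
  ultimately show False by simp
qed

section \<open>A zero limit forces equality\<close>

lemma limit_zero_imp_eq:
  assumes lim: "(p \<longlongrightarrow> 0) (at_right 0)" and R: "0 < R"
  shows "p R = 0 \<and> D R = 0"
proof -
  obtain C where C: "0 < C" "\<And>s t. 0 < s \<Longrightarrow> s \<le> t \<Longrightarrow> t \<le> R \<Longrightarrow> u1 s * u2 s \<le> C * (u1 t * u2 t)"
    by (rule prod_le_mult_later[of R]) blast
  obtain M1 where M1: "0 < M1" "\<And>r. 0 \<le> r \<Longrightarrow> r \<le> R \<Longrightarrow> \<bar>u1 r\<bar> \<le> M1"
    by (rule S1.u_bounded[of R]) blast
  obtain M2 where M2: "0 < M2" "\<And>r. 0 \<le> r \<Longrightarrow> r \<le> R \<Longrightarrow> \<bar>u2 r\<bar> \<le> M2"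
    by (rule S2.u_bounded[of R]) blast
  define U where "U = M1 + M2"
  have U: "0 < U" using M1 M2 by (simp add: U_def)
  have uU: "0 < u1 t \<and> u1 t \<le> U \<and> 0 < u2 t \<and> u2 t \<le> U" if "0 < t" "t \<le> R" for t
    using that S1.u_pos[of t] S2.u_pos[of t] M1(1) M1(2)[of t] M2(1) M2(2)[of t]
    by (auto simp: U_def)
  \<comment> \<open>Against the weight \<open>exp (L * r^2)\<close>, \<open>C\<close> measures the
    influence of \<open>D\<close> on \<open>p\<close>, and \<open>2 * U^2\<close> that of
    \<open>p\<close> on \<open>D\<close> (a factor \<open>2 * U\<close> from \<open>u1 + u2\<close>
    and \<open>U\<close> from \<open>abs_diff_le_ln\<close>). Since the derivative of the weight
    carries \<open>2 * L\<close>, integration bounds the maximum \<open>M\<close> by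
    \<open>M / 2\<close>.\<close>
  define L where "L = C + 2 * U\<^sup>2"
  have L: "0 < L" using C U by (simp add: L_def add_pos_nonneg)
  \<comment> \<open>The value at 0 is set by hand: \<open>u1\<close> and \<open>u2\<close> may
    vanish there, so \<open>p 0\<close> need not be the limit of \<open>p\<close>. With this value
    \<open>P\<close> is continuous on the closed interval and attains a weighted maximum.\<close>
  define P where "P r = (if r = 0 then 0 else \<bar>p r\<bar>) + \<bar>D r\<bar>" for r
  define f where "f r = P r * exp (- (L * r\<^sup>2))" for r
  have "continuous_on {0..R} P"
    unfolding P_def
  proof (intro continuous_intros continuous_on_subset[OF cont_D])
    show "continuous_on {0..R} (\<lambda>r. if r = 0 then 0 else \<bar>p r\<bar>)"
      unfolding continuous_on_def
    proof
      fix x assume x: "x \<in> {0..R}"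
      show "((\<lambda>r. if r = 0 then 0 else \<bar>p r\<bar>) \<longlongrightarrow> (if x = 0 then 0 else \<bar>p x\<bar>)) (at x within {0..R})"
      proof (cases "x = 0")
        case True
        have "((\<lambda>r. \<bar>p r\<bar>) \<longlongrightarrow> 0) (at_right 0)" using tendsto_rabs[OF lim] by simp
        then have "((\<lambda>r. if r = 0 then 0 else \<bar>p r\<bar>) \<longlongrightarrow> 0) (at_right 0)"
          by (rule Lim_transform_eventually) (auto simp: eventually_at_filter)
        moreover have "at (0::real) within {0..R} = at_right 0"
          using R by (intro at_within_Icc_at_right)
        ultimately show ?thesis using True by simp
      next
        case False
        then have x0: "0 < x" using x by simp
        have "(p \<longlongrightarrow> p x) (at x)" using DERIV_isCont[OF DERIV_p[OF x0]] by (simp add: isCont_def)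
        then have "((\<lambda>r. \<bar>p r\<bar>) \<longlongrightarrow> \<bar>p x\<bar>) (at x within {0..R})"
          by (intro tendsto_rabs) (rule tendsto_within_subset[of _ _ _ UNIV], auto)
        then have "((\<lambda>r. if r = 0 then 0 else \<bar>p r\<bar>) \<longlongrightarrow> \<bar>p x\<bar>) (at x within {0..R})"
        proof (rule Lim_transform_eventually)
          have "\<forall>\<^sub>F r in at x within {0..R}. r \<noteq> 0"
            using False by (rule tendsto_imp_eventually_ne[OF tendsto_ident_at])
          then show "\<forall>\<^sub>F r in at x within {0..R}. \<bar>p r\<bar> = (if r = 0 then 0 else \<bar>p r\<bar>)"
            by eventually_elim simp
        qed
        then show ?thesis using False by simp
      qed
    qed
  qed auto
  then have "continuous_on {0..R} f"
    unfolding f_def by (intro continuous_intros)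
  then have "\<exists>x\<in>{0..R}. \<forall>y\<in>{0..R}. f y \<le> f x"
    by (intro continuous_attains_sup) (use R in auto)
  then obtain x where x: "x \<in> {0..R}" "\<And>y. y \<in> {0..R} \<Longrightarrow> f y \<le> f x" by blast
  define M where "M = f x"
  define E where "E r = exp (L * r\<^sup>2)" for r
  have Pf: "P r = f r * E r" for r
    by (simp add: f_def E_def mult.assoc flip: exp_add)
  have E: "0 < E r" for r by (simp add: E_def)
  have E_mono: "E s \<le> E t" if "0 \<le> s" "s \<le> t" for s t
    using that L unfolding E_def by (simp add: power_mono)
  have DERIV_E: "(E has_real_derivative 2 * L * t * E t) (at t)" for t
    unfolding E_def by (auto intro!: derivative_eq_intros)
  have M0: "0 \<le> M" unfolding M_def f_def P_def by auto
  have PM: "P r \<le> M * E r" if "0 \<le> r" "r \<le> R" for r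
    unfolding Pf M_def using x(2)[of r] that E[of r] by (intro mult_right_mono) auto
  have pM: "\<bar>p s\<bar> \<le> M * E t" and DM: "\<bar>D s\<bar> \<le> M * E t" if "0 < s" "s \<le> t" "t \<le> R" for s t
  proof -
    have "P s \<le> M * E s" using PM[of s] that by simp
    also have "\<dots> \<le> M * E t" using E_mono[of s t] that M0 by (intro mult_left_mono) auto
    finally show "\<bar>p s\<bar> \<le> M * E t" "\<bar>D s\<bar> \<le> M * E t" using that by (auto simp: P_def)
  qed
  have "M \<le> 0"
  proof (cases "x = 0")
    case True
    then show ?thesis by (simp add: M_def f_def P_def D_def S1.W_0 S2.W_0)
  next
    case False
    then have x0: "0 < x" "x \<le> R" using x by auto
    have p: "\<bar>p x - 0\<bar> \<le> C * M / (2 * L) * E x - C * M / (2 * L) * E 0"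
    proof (rule abs_diff_limit_at_0_le[OF lim x0(1) DERIV_p])
      show "((\<lambda>t. C * M / (2 * L) * E t) has_real_derivative C * M / (2 * L) * (2 * L * t * E t)) (at t)" for t
        by (intro DERIV_cmult DERIV_E)
      fix t assume t: "0 < t" "t < x"
      have "\<bar>w t / (t * (u1 t * u2 t))\<bar> \<le> C * (M * E t) * t"
        by (rule abs_DERIV_p_le[of t R]) (use t x0 C DM in auto)
      then show "\<bar>w t / (t * (u1 t * u2 t))\<bar> \<le> C * M / (2 * L) * (2 * L * t * E t)"
        using L by (simp add: mult_ac)
    qed
    have D: "\<bar>D x - 0\<bar> \<le> (2 * U\<^sup>2) * M / (2 * L) * E x - (2 * U\<^sup>2) * M / (2 * L) * E 0"
    proof (rule abs_diff_limit_at_0_le[OF D_lim x0(1) DERIV_D])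
      show "((\<lambda>t. (2 * U\<^sup>2) * M / (2 * L) * E t) has_real_derivative
          (2 * U\<^sup>2) * M / (2 * L) * (2 * L * t * E t)) (at t)" for t
        by (intro DERIV_cmult DERIV_E)
      fix t assume t: "0 < t" "t < x"
      define A where "A = 2 * U\<^sup>2 * (M * E t)"
      have "\<bar>g t - 0\<bar> \<le> A * t\<^sup>2 / 2 - A * 0\<^sup>2 / 2"
      proof (rule abs_diff_limit_at_0_le[OF g_lim t(1) DERIV_g])
        show "((\<lambda>t. A * t\<^sup>2 / 2) has_real_derivative A * s) (at s)" for s
          by (auto intro!: derivative_eq_intros)
        fix s assume s: "0 < s" "s < t"
        have us: "0 < u1 s" "u1 s \<le> U" "0 < u2 s" "u2 s \<le> U" using uU[of s] s t x0 by auto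
        have "\<bar>(u2 s)\<^sup>2 - (u1 s)\<^sup>2\<bar> = \<bar>u2 s + u1 s\<bar> * \<bar>u2 s - u1 s\<bar>"
          unfolding abs_mult[symmetric] by (simp only: power2_eq_square square_diff_square_factored)
        also have "\<dots> \<le> (2 * U) * (U * \<bar>p s\<bar>)"
          using abs_diff_le_ln[of "u1 s" "u2 s" U] us U by (intro mult_mono) (auto simp: p_def)
        also have "\<dots> \<le> (2 * U) * (U * (M * E t))"
          using pM[of s t] s t x0 U by (intro mult_left_mono) auto
        also have "\<dots> = A" by (simp add: A_def power2_eq_square)
        finally have "\<bar>(u2 s)\<^sup>2 - (u1 s)\<^sup>2\<bar> \<le> A" .
        then have "s * \<bar>(u2 s)\<^sup>2 - (u1 s)\<^sup>2\<bar> \<le> s * A" using s by (intro mult_left_mono) auto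
        then show "\<bar>s * ((u2 s)\<^sup>2 - (u1 s)\<^sup>2)\<bar> \<le> A * s" using s by (simp add: abs_mult mult.commute)
      qed simp
      moreover have "0 \<le> A" using M0 E[of t] by (simp add: A_def)
      ultimately have "\<bar>g t\<bar> \<le> (A * t) * t" by (simp add: power2_eq_square)
      then have "\<bar>g t / t\<bar> \<le> A * t" using t by (simp add: pos_divide_le_eq)
      then show "\<bar>g t / t\<bar> \<le> (2 * U\<^sup>2) * M / (2 * L) * (2 * L * t * E t)"
        using L by (simp add: A_def mult_ac)
    qed
    have "M * E x = \<bar>p x\<bar> + \<bar>D x\<bar>"
      using Pf[of x] False by (simp add: M_def P_def)
    also have "\<dots> \<le> (C * M / (2 * L) + (2 * U\<^sup>2) * M / (2 * L)) * E x"
    proof -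
      have "0 \<le> C * M / (2 * L) * E 0" "0 \<le> (2 * U\<^sup>2) * M / (2 * L) * E 0"
        using C M0 L E[of 0] by auto
      then show ?thesis unfolding distrib_right using p D by linarith
    qed
    also have "C * M / (2 * L) + (2 * U\<^sup>2) * M / (2 * L) = M / 2"
    proof -
      have "C * M / (2 * L) + (2 * U\<^sup>2) * M / (2 * L) = (L * M) / (2 * L)"
        unfolding add_divide_distrib[symmetric] L_def by (simp add: distrib_right)
      then show ?thesis using L by simp
    qed
    finally have "M * E x \<le> 0" by simp
    then show ?thesis using E[of x] by (simp add: mult_le_0_iff)
  qed
  then have "P R \<le> 0" using PM[of R] R M0 by simp
  then have "\<bar>p R\<bar> + \<bar>D R\<bar> \<le> 0" using R by (simp add: P_def)
  then have "\<bar>p R\<bar> = 0" "\<bar>D R\<bar> = 0" by linarith+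
  then show ?thesis by simp
qed

end

lemma radial_solution_unique:
  assumes sol1: "radial_solution m u1 W1" and sol2: "radial_solution m u2 W2" and r: "0 \<le> r"
  shows "u1 r = u2 r \<and> W1 r = W2 r"
proof -
  interpret S: two_solutions m u1 W1 u2 W2 by unfold_locales fact+
  \<comment> \<open>Swapping the solutions negates \<open>p\<close>, so \<open>T\<close> excludes a
    negative limit.\<close>
  interpret T: two_solutions m u2 W2 u1 W1 by unfold_locales fact+
  obtain l where l: "(S.p \<longlongrightarrow> l) (at_right 0)" using S.p_has_limit by blast
  have "T.p = (\<lambda>r. - S.p r)" by (auto simp: S.p_def T.p_def)
  then have "(T.p \<longlongrightarrow> - l) (at_right 0)" using tendsto_minus[OF l] by simp
  then have "\<not> l < 0" using T.limit_not_pos[of "- l"] by auto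
  moreover have "\<not> 0 < l" using S.limit_not_pos[OF l] by auto
  ultimately have "l = 0" by simp
  have eq: "u1 x = u2 x \<and> W1 x = W2 x" if "0 < x" for x
    using S.limit_zero_imp_eq[OF l[unfolded \<open>l = 0\<close>] that] S.S1.u_pos[OF that] S.S2.u_pos[OF that]
    by (simp add: S.p_def S.D_def)
  \<comment> \<open>The log-ratio only compares the solutions for \<open>r > 0\<close>; the value at
    the origin follows by continuity.\<close>
  have "u1 0 = u2 0"
  proof (rule tendsto_unique)
    have "(u1 \<longlongrightarrow> u1 0) (at 0 within {0..})" "(u2 \<longlongrightarrow> u2 0) (at 0 within {0..})"
      using S.S1.cont_u S.S2.cont_u unfolding continuous_on_def by blast+
    then have lims: "(u1 \<longlongrightarrow> u1 0) (at_right 0)" "(u2 \<longlongrightarrow> u2 0) (at_right 0)"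
      by (auto elim!: tendsto_within_subset)
    then show "(u1 \<longlongrightarrow> u1 0) (at_right 0)" by simp
    show "(u1 \<longlongrightarrow> u2 0) (at_right 0)"
      by (rule Lim_transform_eventually[OF lims(2)]) (use eq in \<open>auto simp: eventually_at_filter\<close>)
  qed simp
  then show ?thesis using eq[of r] r S.S1.W_0 S.S2.W_0 by (cases "r = 0") auto
qed

theorem theorem5p2:
  fixes m :: nat
  shows "(\<exists>u W. radial_solution m u W) \<and>
         (\<forall>u1 W1 u2 W2. radial_solution m u1 W1 \<longrightarrow> radial_solution m u2 W2 \<longrightarrow>
            (\<forall>r\<ge>0. u1 r = u2 r \<and> W1 r = W2 r))"
  using radial_solution_exists[of m] radial_solution_unique[of m] by blast

end
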